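(* Let $q$ be a complex number with $0<|q|<1$, and for $r\in\{1,3\}$ put $$u_r:=\frac{f_r f_{3r}}{q^r f_{7r}f_{21r}}.$$ If $P:=u_1u_3$ and $Q:=\dfrac{u_1}{u_3}$, then $$Q^3+\frac{1}{Q^3}=5\left(Q^2+\frac{1}{Q^2}\right)+20\left(Q+\frac{1}{Q}\right)+\left(P+\frac{7^2}{P}\right)\left[Q+\frac{1}{Q}+1\right]+3\left(\sqrt{P}+\frac{7}{\sqrt P}\right)\left[\left(\sqrt{Q^3}+\frac{1}{\sqrt{Q^3}}\right)+3\left(\sqrt{Q}+\frac{1}{\sqrt{Q}}\right)\right]+42.$$
   Context: For $|q|<1$, $f(-q):=\sum_{n=-\infty}^{\infty}(-1)^n q^{n(3n-1)/2}$, and $f_n:=f(-q^n)$ for positive integers $n$ (so $f_n$ is $f(-x)$ evaluated at $x=q^n$). Square roots: $\sqrt P$ and $\sqrt Q$ denote square roots of $P$ and $Q$ chosen so that $\sqrt P\,\sqrt Q=u_1$ (for $0<q<1$ these are the positive square roots), and $\sqrt{Q^3}:=(\sqrt Q)^3$. *)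

theory Defs
  imports "HOL-Analysis.Analysis"
begin

text \<open>
  Ramanujan's \<open>f(-q)\<close>, as a function of \<open>q\<close> (not of \<open>-q\<close>). The sum is over all integers and
  converges absolutely for \<open>norm q < 1\<close>; the exponents \<open>n (3 n - 1) / 2\<close> are nonnegative
  integers, so \<open>div\<close> is exact.
\<close>
definition f_minus :: "complex \<Rightarrow> complex" where
  "f_minus q = (\<Sum>\<^sub>\<infinity>n::int. (-1) powi n * q powi (n * (3 * n - 1) div 2))"

definition f_sub :: "complex \<Rightarrow> nat \<Rightarrow> complex" where
  "f_sub q n = f_minus (q ^ n)"

definition u :: "complex \<Rightarrow> nat \<Rightarrow> complex" where
  "u q r = f_sub q r * f_sub q (3 * r) / (q ^ r * f_sub q (7 * r) * f_sub q (21 * r))"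

end

theory Submission
  imports Defs "HOL-Complex_Analysis.Complex_Analysis" "HOL-Probability.Characteristic_Functions"
begin

text \<open>
  Put \<open>a = f\<^sub>1/(q\<^sup>1\<^sup>/\<^sup>4 f\<^sub>7)\<close>, \<open>b = f\<^sub>3/(q\<^sup>3\<^sup>/\<^sup>4 f\<^sub>2\<^sub>1)\<close>, \<open>c = f\<^sub>9/(q\<^sup>9\<^sup>/\<^sup>4 f\<^sub>6\<^sub>3)\<close>, so that
  \<open>u\<^sub>1 = ab\<close> and \<open>u\<^sub>3 = bc\<close>. Ramanujan's level 21 identity \<open>ab + 7/(ab) + 3 = (b/a)\<^sup>2 + (a/b)\<^sup>2\<close>,
  applied at \<open>q\<close> and at \<open>q\<^sup>3\<close>, gives two quadratic equations for \<open>b\<^sup>4\<close> with coefficients in \<open>u\<^sub>1\<close> and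
  \<open>u\<^sub>3\<close>; their resultant is \<open>(u\<^sub>1 - u\<^sub>3)\<^sup>2\<close> times the polynomial form of the claim, and the zeros of
  \<open>u\<^sub>1 - u\<^sub>3\<close> are removed by analytic continuation.

  The difference of the two sides of the level 21 identity extends holomorphically to the disc
  \<open>norm q < 1\<close>, with value \<open>0\<close> at \<open>q = 0\<close>. It is invariant under the Fricke and Atkin-Lehner
  involutions of level 21, by which every \<open>\<tau>\<close> can be moved up to \<open>Im \<tau> \<ge> 1/50\<close>. Hence its modulus attains
  its maximum on a smaller closed disc, and the difference is constant. The invariance rests on the
  transformation law of the eta function, which for purely imaginary \<open>\<tau>\<close> is Poisson summation
  applied to the pentagonal series.
\<close>

section \<open>Euler's function and its product\<close>

text \<open>The symmetric intervals eventually contain every finite set of integers, so the net of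
  finite partial sums can be followed along them. This links unordered sums with Fourier partial
  sums and with the finite pentagonal identity.\<close>

lemma has_sum_int_symmetric:
  fixes f :: "int \<Rightarrow> 'a::{comm_monoid_add,topological_space}"
  assumes "(f has_sum S) UNIV"
  shows "(\<lambda>N. \<Sum>k\<in>{-int N..int N}. f k) \<longlonglongrightarrow> S"
proof -
  have "filterlim (\<lambda>N. {-int N..int N}) (finite_subsets_at_top UNIV) sequentially"
    unfolding filterlim_finite_subsets_at_top
  proof safe
    fix X :: "int set" assume "finite X"
    then obtain B where B: "\<And>x. x \<in> X \<Longrightarrow> \<bar>x\<bar> \<le> B"
      by (metis abs_le_D1 bdd_above_def bdd_above_finite finite_imageI imageI)
    show "\<forall>\<^sub>F N in sequentially. finite {- int N..int N} \<and> X \<subseteq> {- int N..int N} \<and> {- int N..int N} \<subseteq> UNIV"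
      using eventually_ge_at_top[of "nat B"]
    proof eventually_elim
      case (elim N)
      thus ?case using B by fastforce
    qed
  qed
  from filterlim_compose[OF assms[unfolded has_sum_def] this] show ?thesis .
qed

lemma summable_on_intI:
  fixes f :: "int \<Rightarrow> 'a::banach"
  assumes "(\<lambda>n. f (int n)) summable_on UNIV" "(\<lambda>n. f (- int n)) summable_on UNIV"
  shows "f summable_on UNIV"
proof -
  have "f summable_on (range int)"
    using assms(1) by (subst summable_on_reindex) (auto simp: o_def)
  moreover have "f summable_on ((\<lambda>n. - int n) ` UNIV)"
    using assms(2) by (subst summable_on_reindex) (auto simp: o_def inj_on_def)
  \<comment> \<open>Both ranges contain \<open>0\<close>, which must be counted only once.\<close>
  hence "f summable_on ((\<lambda>n. - int n) ` UNIV - range int)"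
    by (rule summable_on_subset_banach) auto
  ultimately have "f summable_on (range int \<union> ((\<lambda>n. - int n) ` UNIV - range int))"
    by (rule summable_on_Un_disjoint) auto
  moreover have "range int \<union> ((\<lambda>n. - int n) ` UNIV - range int) = UNIV"
    by (auto simp: image_iff) (metis int_cases2)
  ultimately show ?thesis by simp
qed

lemma summable_on_geometric_int:
  fixes r :: real
  assumes "0 \<le> r" "r < 1"
  shows "(\<lambda>n::int. r ^ nat \<bar>n\<bar>) summable_on UNIV"
proof -
  have "(\<lambda>n::nat. r ^ n) summable_on UNIV"
    using assms by (intro summable_nonneg_imp_summable_on summable_geometric) auto
  thus ?thesis by (intro summable_on_intI) auto
qed

text \<open>Weierstrass M-test on a closed disc around each point: the finite partial sums are
  holomorphic and converge uniformly there.\<close>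

lemma holomorphic_on_infsum:
  fixes f :: "'i \<Rightarrow> complex \<Rightarrow> complex"
  assumes "open S" "\<And>n. n \<in> I \<Longrightarrow> f n holomorphic_on S"
    and "\<And>z. z \<in> S \<Longrightarrow> \<exists>r>0. \<exists>M. cball z r \<subseteq> S \<and> M summable_on I
            \<and> (\<forall>n\<in>I. \<forall>w\<in>cball z r. norm (f n w) \<le> M n)"
  shows "(\<lambda>z. \<Sum>\<^sub>\<infinity>n\<in>I. f n z) holomorphic_on S"
proof -
  have "(\<lambda>z. \<Sum>\<^sub>\<infinity>n\<in>I. f n z) field_differentiable (at z)" if "z \<in> S" for z
  proof -
    from assms(3)[OF that] obtain r M where r: "r > 0" "cball z r \<subseteq> S" "M summable_on I"
      "\<And>n w. n \<in> I \<Longrightarrow> w \<in> cball z r \<Longrightarrow> norm (f n w) \<le> M n" by blast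
    have ul: "uniform_limit (cball z r) (\<lambda>X w. \<Sum>n\<in>X. f n w) (\<lambda>w. \<Sum>\<^sub>\<infinity>n\<in>I. f n w) (finite_subsets_at_top I)"
      using r by (intro Weierstrass_m_test_general) auto
    have ev: "\<forall>\<^sub>F X in finite_subsets_at_top I. continuous_on (cball z r) (\<lambda>w. \<Sum>n\<in>X. f n w) \<and>
        (\<lambda>w. \<Sum>n\<in>X. f n w) holomorphic_on ball z r"
    proof (rule eventually_finite_subsets_at_top_weakI)
      fix X assume X: "finite X" "X \<subseteq> I"
      have "(\<lambda>w. \<Sum>n\<in>X. f n w) holomorphic_on S"
        using X assms(2) by (intro holomorphic_on_sum) auto
      thus "continuous_on (cball z r) (\<lambda>w. \<Sum>n\<in>X. f n w) \<and> (\<lambda>w. \<Sum>n\<in>X. f n w) holomorphic_on ball z r"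
        using r(2) ball_subset_cball[of z r]
        by (meson holomorphic_on_imp_continuous_on holomorphic_on_subset order_trans)
    qed
    obtain "(\<lambda>w. \<Sum>\<^sub>\<infinity>n\<in>I. f n w) holomorphic_on ball z r"
      by (rule holomorphic_uniform_limit[OF ev ul]) auto
    thus ?thesis using r(1)
      by (simp add: holomorphic_on_imp_differentiable_at)
  qed
  thus ?thesis by (simp add: field_differentiable_at_within holomorphic_on_def)
qed

section \<open>Pentagonal exponents and the series of \<open>f_minus\<close>\<close>

text \<open>With exponents in \<open>nat\<close> the terms are polynomials in \<open>q\<close>,
  which makes holomorphy and the behaviour at \<open>q = 0\<close> immediate.\<close>

definition pent :: "int \<Rightarrow> nat" where
  "pent n = nat (n * (3 * n - 1) div 2)"

lemma pent_double: "2 * int (pent n) = n * (3 * n - 1)"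
proof -
  have "even (n * (3 * n - 1))" by auto
  moreover have "n * (3 * n - 1) \<ge> 0"
    by (cases "n \<ge> 1") (auto simp: zero_le_mult_iff)
  ultimately show ?thesis by (simp add: pent_def)
qed

text \<open>A linear lower bound is enough to dominate the series by a two-sided geometric
  series.\<close>

lemma pent_ge: "nat \<bar>n\<bar> \<le> pent n"
proof -
  have "2 * \<bar>n\<bar> \<le> n * (3 * n - 1)"
  proof (cases "n \<ge> 1")
    case True
    hence "n * 2 \<le> n * (3 * n - 1)" by (intro mult_left_mono) auto
    thus ?thesis using True by simp
  next
    case False
    hence "(-n) * 2 \<le> (-n) * (1 - 3 * n)"
      by (cases "n = 0") (auto intro!: mult_left_mono)
    thus ?thesis using False by (simp add: algebra_simps)
  qed
  thus ?thesis using pent_double[of n] by linarith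
qed

text \<open>The surplus \<open>2\<close> extracts a factor \<open>q ^ 2\<close> from the tail of the
  series. The bound fails at \<open>n = -1\<close>, where \<open>pent\<close> is exactly
  \<open>2\<close>.\<close>

lemma pent_ge': "\<bar>n\<bar> \<ge> 2 \<Longrightarrow> nat \<bar>n\<bar> + 2 \<le> pent n"
proof -
  assume n: "\<bar>n\<bar> \<ge> 2"
  have "2 * \<bar>n\<bar> + 4 \<le> n * (3 * n - 1)"
  proof (cases "n \<ge> 2")
    case True
    hence "n * 5 \<le> n * (3 * n - 1)" by (intro mult_left_mono) auto
    thus ?thesis using True by linarith
  next
    case False
    hence "(-n) * 7 \<le> (-n) * (1 - 3 * n)"
      using n by (intro mult_left_mono) auto
    thus ?thesis using False n by (simp add: algebra_simps)
  qed
  thus ?thesis using pent_double[of n] by linarith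
qed

lemma f_minus_altdef: "f_minus q = (\<Sum>\<^sub>\<infinity>n::int. (-1) powi n * q ^ pent n)"
proof -
  have "q powi (n * (3 * n - 1) div 2) = q ^ pent n" for n
    using pent_double[of n]
    by (metis pent_def power_int_of_nat int_nat_eq nonzero_mult_div_cancel_left
        of_nat_0_le_iff zero_neq_numeral)
  thus ?thesis by (simp add: f_minus_def)
qed

lemma norm_minus_one_powi [simp]: "norm ((-1::complex) powi n) = 1"
  by (simp add: norm_power_int)

lemma f_minus_term_bound:
  fixes q :: complex
  assumes "norm q \<le> r" "r \<le> 1"
  shows "norm ((-1) powi n * q ^ pent n) \<le> r ^ nat \<bar>n\<bar>"
proof -
  have r: "0 \<le> r" using assms(1) norm_ge_zero order_trans by blast
  have "norm ((-1) powi n * q ^ pent n) = norm q ^ pent n"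
    by (simp add: norm_mult norm_power)
  also have "\<dots> \<le> r ^ pent n" using assms by (intro power_mono) auto
  also have "\<dots> \<le> r ^ nat \<bar>n\<bar>" using assms r by (intro power_decreasing pent_ge) auto
  finally show ?thesis .
qed

lemma f_minus_has_sum:
  assumes "norm q < 1"
  shows "((\<lambda>n::int. (-1) powi n * q ^ pent n) has_sum f_minus q) UNIV"
proof -
  have "(\<lambda>n::int. norm ((-1) powi n * q ^ pent n)) summable_on UNIV"
    using assms
    by (intro Infinite_Sum.abs_summable_on_comparison_test'[OF summable_on_geometric_int[of "norm q"]]
        f_minus_term_bound) auto
  thus ?thesis unfolding f_minus_altdef by (intro has_sum_infsum) (rule abs_summable_summable)
qed

lemma holomorphic_f_minus: "f_minus holomorphic_on ball 0 1"
proof -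
  have "(\<lambda>q. \<Sum>\<^sub>\<infinity>n::int. (-1) powi n * q ^ pent n) holomorphic_on ball 0 1"
  proof (rule holomorphic_on_infsum)
    fix z :: complex assume z: "z \<in> ball 0 1"
    \<comment> \<open>Half the distance to the unit circle: on \<open>cball z r\<close> the norm is
      at most \<open>1 - r < 1\<close>, the ratio of the majorant.\<close>
    define r where "r = (1 - norm z) / 2"
    have w: "norm w \<le> 1 - r" if "w \<in> cball z r" for w
      using that norm_triangle_ineq[of z "w - z"] z
      by (auto simp: r_def dist_norm norm_minus_commute field_simps)
    have "0 < r" "r < 1" using z by (auto simp: r_def) (smt (verit) norm_ge_zero)
    thus "\<exists>r>0. \<exists>M. cball z r \<subseteq> ball 0 1 \<and> M summable_on UNIV \<and>
       (\<forall>n\<in>UNIV. \<forall>w\<in>cball z r. norm ((-1) powi n * w ^ pent n) \<le> M n)"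
      using w summable_on_geometric_int[of "1 - r"] f_minus_term_bound[of _ "1 - r"]
      by (intro exI[of _ r] conjI exI[of _ "\<lambda>n. (1 - r) ^ nat \<bar>n\<bar>"]) (fastforce)+
  qed (auto intro!: holomorphic_intros)
  thus ?thesis unfolding f_minus_altdef[abs_def] .
qed

lemma f_minus_0 [simp]: "f_minus 0 = 1"
proof -
  have "((\<lambda>n::int. (-1) powi n * 0 ^ pent n) has_sum (\<Sum>n\<in>{0}. (-1::complex) powi n * 0 ^ pent n)) UNIV"
  proof (rule has_sum_finite_neutralI)
    fix n :: int assume "n \<in> UNIV - {0}"
    hence "pent n \<noteq> 0" using pent_ge[of n] by auto
    thus "(-1::complex) powi n * 0 ^ pent n = 0" by simp
  qed auto
  moreover have "(\<Sum>n\<in>{0}. (-1::complex) powi n * 0 ^ pent n) = 1" by (simp add: pent_def)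
  ultimately show ?thesis using f_minus_has_sum[of 0] has_sum_unique by fastforce
qed

text \<open>The series starts with \<open>1 - q\<close> and the rest is \<open>O(q^2)\<close>. The
  linear term is needed to extend the level 21 difference across \<open>q = 0\<close>.\<close>

lemma f_minus_deriv_0: "(f_minus has_field_derivative -1) (at 0)"
proof -
  \<comment> \<open>The factor \<open>2\<close> lets the term \<open>n = -1\<close>, of size exactly
    \<open>norm q ^ 2\<close>, fit under the same majorant as the others.\<close>
  define C where "C = 2 * (\<Sum>\<^sub>\<infinity>n::int. (1/2::real) ^ nat \<bar>n\<bar>)"
  have bound: "norm (f_minus q - (1 - q)) \<le> C * norm q ^ 2" if q: "norm q \<le> 1/2" for q
  proof -
    let ?t = "\<lambda>n::int. (-1) powi n * q ^ pent n"
    have 1: "(?t has_sum f_minus q) UNIV" using q by (intro f_minus_has_sum) auto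
    have 2: "(?t has_sum (\<Sum>n\<in>{0,1}. ?t n)) {0,1}" by (rule has_sum_finite) auto
    have p: "pent 0 = 0" "pent 1 = 1" "pent (-1) = 2" by (auto simp: pent_def)
    have 3: "(?t has_sum (f_minus q - (1 - q))) (UNIV - {0,1})"
      using has_sum_Diff[OF 1 2] by (simp add: p)
    have "((\<lambda>n::int. 2 * (1/2::real) ^ nat \<bar>n\<bar> * norm q ^ 2) has_sum C * norm q ^ 2) UNIV"
      unfolding C_def
      by (intro has_sum_cmult_left has_sum_cmult_right has_sum_infsum summable_on_geometric_int) auto
    hence S: "(\<lambda>n::int. 2 * (1/2::real) ^ nat \<bar>n\<bar> * norm q ^ 2) summable_on UNIV"
         "(\<Sum>\<^sub>\<infinity>n::int. 2 * (1/2::real) ^ nat \<bar>n\<bar> * norm q ^ 2) = C * norm q ^ 2"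
      by (auto simp: has_sum_iff)
    have "norm (f_minus q - (1 - q)) \<le> (\<Sum>\<^sub>\<infinity>n\<in>UNIV - {0,1}. 2 * (1/2::real) ^ nat \<bar>n\<bar> * norm q ^ 2)"
    proof (rule norm_infsum_le[OF 3 has_sum_infsum])
      show "(\<lambda>n::int. 2 * (1/2::real) ^ nat \<bar>n\<bar> * norm q ^ 2) summable_on (UNIV - {0,1})"
        by (rule summable_on_subset_banach[OF S(1)]) auto
      fix n :: int assume n: "n \<in> UNIV - {0,1}"
      have *: "norm (?t n) = norm q ^ pent n" by (simp add: norm_mult norm_power)
      show "norm (?t n) \<le> 2 * (1/2) ^ nat \<bar>n\<bar> * norm q ^ 2"
      proof (cases "n = -1")
        case True
        thus ?thesis by (simp add: * p norm_power)
      next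
        case False
        with n have "nat \<bar>n\<bar> + 2 \<le> pent n" by (intro pent_ge') auto
        hence "norm q ^ pent n \<le> norm q ^ (nat \<bar>n\<bar> + 2)" using q by (intro power_decreasing) auto
        also have "\<dots> \<le> (1/2) ^ nat \<bar>n\<bar> * norm q ^ 2"
          using q unfolding power_add by (intro mult_right_mono power_mono) auto
        also have "\<dots> \<le> 2 * (1/2) ^ nat \<bar>n\<bar> * norm q ^ 2"
          by (intro mult_right_mono) auto
        finally show ?thesis by (simp add: *)
      qed
    qed
    also have "\<dots> \<le> (\<Sum>\<^sub>\<infinity>n::int. 2 * (1/2::real) ^ nat \<bar>n\<bar> * norm q ^ 2)"
      by (intro infsum_mono_neutral S(1) summable_on_subset_banach[OF S(1)]) auto
    finally show ?thesis by (simp add: S(2))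
  qed
  have "((\<lambda>q. (f_minus q - f_minus 0) / (q - 0) - (-1)) \<longlongrightarrow> 0) (at 0)"
  proof (rule Lim_null_comparison)
    have "\<forall>\<^sub>F q in at 0. q \<noteq> 0 \<and> norm (q::complex) < 1/2"
      unfolding eventually_at by (intro exI[of _ "1/2"]) (auto simp: dist_norm)
    thus "\<forall>\<^sub>F q in at 0. norm ((f_minus q - f_minus 0) / (q - 0) - (-1)) \<le> C * norm q"
    proof eventually_elim
      case (elim q)
      have "(f_minus q - f_minus 0) / (q - 0) - (-1) = (f_minus q - (1 - q)) / q"
        using elim by (simp add: field_simps)
      also have "norm \<dots> \<le> C * norm q ^ 2 / norm q"
        unfolding norm_divide using elim by (intro divide_right_mono bound) auto
      finally show ?case using elim by (simp add: power2_eq_square)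
    qed
    show "((\<lambda>q::complex. C * norm q) \<longlongrightarrow> 0) (at 0)"
      by (auto intro!: tendsto_eq_intros)
  qed
  thus ?thesis unfolding has_field_derivative_iff using LIM_zero_iff by blast
qed

text \<open>Shanks' finite form of Euler's pentagonal number theorem; the term \<open>s = 0\<close> is the partial product.\<close>

lemma shanks_pentagonal:
  fixes q :: complex
  shows "(\<Sum>k\<in>{-int n..int n}. (-1) powi k * q ^ pent k) =
    (\<Sum>s\<le>n. (-1) ^ s * (\<Prod>j\<in>{s<..n}. 1 - q ^ j) * q ^ (s * n + s * (s + 1) div 2))"
proof (induction n)
  case 0
  show ?case by (simp add: pent_def)
next
  case (Suc n)
  define R where "R = (\<lambda>s n. \<Prod>j\<in>{s<..n}. 1 - q ^ j)"
  define t where "t = (\<lambda>n s. (-1) ^ s * R s n * q ^ (s * n + s * (s + 1) div 2))"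
  \<comment> \<open>Telescoping certificate: passing from \<open>n\<close> to \<open>n + 1\<close>
    changes the \<open>s\<close>-th summand by \<open>w (s - 1) - w s\<close>, where the first part
    is absent for \<open>s = 0\<close>.\<close>
  define w where "w = (\<lambda>s. t n s * q ^ (n + 1 + s))"
  have step: "t (Suc n) s - t n s = (if s = 0 then 0 else w (s - 1)) - w s" if "s \<le> n" for s
  proof -
    have "{s<..Suc n} = insert (Suc n) {s<..n}" using that by auto
    hence Rs: "R s (Suc n) = R s n * (1 - q ^ (n + 1))" by (simp add: R_def)
    have t: "t (Suc n) s = t n s * (1 - q ^ (n + 1)) * q ^ s"
      unfolding t_def Rs by (simp add: power_add)
    show ?thesis
    proof (cases s)
      case 0
      thus ?thesis using t by (simp add: w_def algebra_simps power_add)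
    next
      case (Suc r)
      have "{r<..n} = insert s {s<..n}" using that Suc by auto
      hence R: "R r n = R s n * (1 - q ^ s)" by (simp add: R_def)
      have e: "s * n + s * (s + 1) div 2 = r * n + r * (r + 1) div 2 + (n + 1 + r)"
        by (simp add: Suc)
      have "s - 1 = r" using Suc by simp
      hence "w (s - 1) = (-1) ^ r * R r n * q ^ (r * n + r * (r + 1) div 2 + (n + 1 + r))"
        unfolding w_def t_def power_add by (metis mult.assoc)
      also have "\<dots> = (-1) ^ r * (R s n * (1 - q ^ s)) * q ^ (s * n + s * (s + 1) div 2)"
        unfolding e R by (rule refl)
      also have "(-1) ^ r * (R s n * (1 - q ^ s)) = (-1) ^ s * R s n * (q ^ s - 1)" by (simp add: Suc algebra_simps)
      also have "\<dots> * q ^ (s * n + s * (s + 1) div 2) = t n s * (q ^ s - 1)" by (simp only: t_def mult_ac)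
      finally have "w (s - 1) = t n s * (q ^ s - 1)" .
      moreover have "w s = t n s * (q ^ (n + 1) * q ^ s)" by (simp only: w_def power_add)
      moreover have "s \<noteq> 0" using Suc by simp
      ultimately show ?thesis unfolding t by (simp add: algebra_simps del: One_nat_def)
    qed
  qed
  have tel: "(\<Sum>s\<le>m. (if s = 0 then 0 else w (s - 1)) - w s) = - w m" for m
    by (induction m) auto
  have "(\<Sum>s\<le>Suc n. t (Suc n) s) = (\<Sum>s\<le>n. t n s) + (\<Sum>s\<le>n. t (Suc n) s - t n s) + t (Suc n) (Suc n)"
    by (simp add: sum_subtractf)
  also have "(\<Sum>s\<le>n. t (Suc n) s - t n s) = - w n"
    using step tel[of n] by simp
  also have "(\<Sum>s\<le>n. t n s) = (\<Sum>k\<in>{-int n..int n}. (-1) powi k * q ^ pent k)"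
    using Suc.IH by (simp add: t_def R_def)
  \<comment> \<open>What survives the telescoping, \<open>- w n\<close> and the new summand
    \<open>s = n + 1\<close>, are the terms \<open>k = n + 1\<close> and \<open>k = -(n + 1)\<close>
    of the left-hand side.\<close>
  also have "- w n = (-1) powi int (Suc n) * q ^ pent (int (Suc n))"
  proof -
    have ev: "even (n * (n + 1))" by simp
    have "2 * int (n * n + n * (n + 1) div 2 + (n + 1 + n)) = 2 * int (pent (int (Suc n)))"
      unfolding pent_double using ev by (auto simp: algebra_simps zdiv_int elim!: evenE)
    hence "n * n + n * (n + 1) div 2 + (n + 1 + n) = pent (int (Suc n))" by (metis mult_left_cancel of_nat_eq_iff zero_neq_numeral)
    hence "q ^ (n * n + n * (n + 1) div 2) * q ^ (n + 1 + n) = q ^ pent (int (Suc n))"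
      unfolding power_add[symmetric] by (rule arg_cong)
    thus ?thesis unfolding power_int_of_nat
      by (simp only: w_def t_def R_def mult.assoc) simp
  qed
  also have "t (Suc n) (Suc n) = (-1) powi (- int (Suc n)) * q ^ pent (- int (Suc n))"
  proof -
    have ev: "even (Suc n * (Suc n + 1))" by simp
    have "2 * int (Suc n * Suc n + Suc n * (Suc n + 1) div 2) = 2 * int (pent (- int (Suc n)))"
      unfolding pent_double using ev by (auto simp: algebra_simps zdiv_int elim!: evenE)
    hence pe: "Suc n * Suc n + Suc n * (Suc n + 1) div 2 = pent (- int (Suc n))" by (metis mult_left_cancel of_nat_eq_iff zero_neq_numeral)
    have pw: "(-1::complex) powi (- int (Suc n)) = (-1) ^ Suc n"
      unfolding power_int_minus power_int_of_nat power_inverse[symmetric] by simp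
    show ?thesis unfolding pw pe[symmetric] t_def R_def by simp
  qed
  also have "(\<Sum>k\<in>{-int n..int n}. (-1) powi k * q ^ pent k) + (-1) powi int (Suc n) * q ^ pent (int (Suc n))
     + (-1) powi (- int (Suc n)) * q ^ pent (- int (Suc n)) =
     (\<Sum>k\<in>{-int (Suc n)..int (Suc n)}. (-1) powi k * q ^ pent k)"
  proof -
    have "{-int (Suc n)..int (Suc n)} = insert (- int (Suc n)) (insert (int (Suc n)) {-int n..int n})" by auto
    thus ?thesis by simp
  qed
  finally show ?case by (simp add: t_def R_def)
qed

text \<open>In Shanks' identity the summand \<open>s = 0\<close> is the partial product, and each of
  the other \<open>n\<close> summands is at most \<open>C * norm q ^ n\<close>, so series and
  product have the same limit. The product is what excludes zeros of \<open>f_minus\<close>.\<close>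

lemma f_minus_has_prod:
  assumes q: "norm q < 1"
  shows "(\<lambda>n. 1 - q ^ Suc n) has_prod f_minus q"
proof -
  have abs: "abs_convergent_prod (\<lambda>n. 1 - q ^ Suc n)"
    using q by (auto simp: abs_convergent_prod_conv_summable norm_power norm_mult
                     intro!: summable_mult summable_geometric)
  hence conv: "convergent_prod (\<lambda>n. 1 - q ^ Suc n)" by (rule abs_convergent_prod_imp_convergent_prod)
  define P where "P = (\<lambda>n. \<Prod>j\<in>{0<..n}. 1 - q ^ j)"
  have P_alt: "P n = (\<Prod>i<n. 1 - q ^ Suc i)" for n
    unfolding P_def by (rule prod.reindex_bij_witness[of _ Suc "\<lambda>j. j - 1"]) auto
  \<comment> \<open>Since \<open>1 + x \<le> exp x\<close>, the exponential of the full geometric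
    series bounds all products over \<open>{s<..n}\<close> at once.\<close>
  define C where "C = exp (1 / (1 - norm q))"
  have R: "norm (\<Prod>j\<in>{s<..n}. 1 - q ^ j) \<le> C" for s n :: nat
  proof -
    have "norm (\<Prod>j\<in>{s<..n}. 1 - q ^ j) \<le> (\<Prod>j\<in>{s<..n}. 1 + norm q ^ j)"
      unfolding prod_norm[symmetric]
      by (intro prod_mono) (auto intro: order_trans[OF norm_triangle_ineq4] simp: norm_power)
    also have "\<dots> \<le> exp (\<Sum>j\<in>{s<..n}. norm q ^ j)" by (intro prod_le_exp_sum) auto
    also have "(\<Sum>j\<in>{s<..n}. norm q ^ j) \<le> (\<Sum>j. norm q ^ j)"
      using q by (intro sum_le_suminf summable_geometric) auto
    also have "\<dots> = 1 / (1 - norm q)" using q by (intro suminf_geometric) auto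
    finally show ?thesis by (simp add: C_def)
  qed
  have "(\<lambda>n. (\<Sum>k\<in>{-int n..int n}. (-1) powi k * q ^ pent k) - P n) \<longlonglongrightarrow> 0"
  proof (rule Lim_null_comparison)
    show "\<forall>\<^sub>F n in sequentially. norm ((\<Sum>k\<in>{-int n..int n}. (-1) powi k * q ^ pent k) - P n) \<le> C * (real n * norm q ^ n)"
    proof (rule always_eventually, rule allI)
      fix n :: nat
      have "{..n} = insert 0 {0<..n}" by auto
      hence "(\<Sum>k\<in>{-int n..int n}. (-1) powi k * q ^ pent k) - P n =
         (\<Sum>s\<in>{0<..n}. (-1) ^ s * (\<Prod>j\<in>{s<..n}. 1 - q ^ j) * q ^ (s * n + s * (s + 1) div 2))"
        unfolding shanks_pentagonal by (simp add: P_def)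
      also have "norm \<dots> \<le> (\<Sum>s\<in>{0<..n}. C * norm q ^ n)"
      proof (rule sum_norm_le)
        fix s assume s: "s \<in> {0<..n}"
        have "norm q ^ (s * n + s * (s + 1) div 2) \<le> norm q ^ n"
        proof (rule power_decreasing)
          show "n \<le> s * n + s * (s + 1) div 2" using s by (cases s) auto
        qed (use q in auto)
        moreover have "0 \<le> C" by (simp add: C_def)
        ultimately show "norm ((-1) ^ s * (\<Prod>j\<in>{s<..n}. 1 - q ^ j) * q ^ (s * n + s * (s + 1) div 2)) \<le> C * norm q ^ n"
          unfolding norm_mult norm_power using R[of s n] by (simp add: mult_mono)
      qed
      finally show "norm ((\<Sum>k\<in>{-int n..int n}. (-1) powi k * q ^ pent k) - P n) \<le> C * (real n * norm q ^ n)"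
        by (simp add: mult_ac)
    qed
    have "(\<lambda>n. real n * norm q ^ n) \<longlonglongrightarrow> 0"
      using q by (intro powser_times_n_limit_0) auto
    thus "(\<lambda>n. C * (real n * norm q ^ n)) \<longlonglongrightarrow> 0" by (rule tendsto_mult_right_zero)
  qed
  moreover have "(\<lambda>n. \<Sum>k\<in>{-int n..int n}. (-1) powi k * q ^ pent k) \<longlonglongrightarrow> f_minus q"
    using f_minus_has_sum[OF q] by (rule has_sum_int_symmetric)
  ultimately have "P \<longlonglongrightarrow> f_minus q"
    using tendsto_diff by fastforce
  moreover have "(\<lambda>n. \<Prod>i<n. 1 - q ^ Suc i) \<longlonglongrightarrow> prodinf (\<lambda>n. 1 - q ^ Suc n)"
    using convergent_prod_LIMSEQ[OF conv] LIMSEQ_lessThan_iff_atMost by blast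
  ultimately have "f_minus q = prodinf (\<lambda>n. 1 - q ^ Suc n)"
    unfolding P_alt[abs_def] by (rule LIMSEQ_unique)
  thus ?thesis using conv by (metis convergent_prod_has_prod)
qed

lemma f_minus_nonzero:
  assumes "norm q < 1"
  shows "f_minus q \<noteq> 0"
proof -
  have "1 - q ^ Suc n \<noteq> 0" for n
  proof
    assume "1 - q ^ Suc n = 0"
    hence "norm (q ^ Suc n) = 1" by simp
    moreover have "norm q ^ Suc n \<le> norm q ^ 1" using assms by (intro power_decreasing) auto
    ultimately show False using assms unfolding norm_power power_one_right by linarith
  qed
  hence "0 \<notin> range (\<lambda>n. 1 - q ^ Suc n)" unfolding image_iff by metis
  thus ?thesis unfolding has_prod_eq_0_iff[OF f_minus_has_prod[OF assms]] .
qed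

section \<open>Fourier series at a point\<close>

text \<open>The exponential normalised to period \<open>1\<close>; at a point \<tau> of the upper
  half-plane its value is \<open>q\<close>.\<close>

definition cexp :: "complex \<Rightarrow> complex" where
  "cexp z = exp (2 * of_real pi * \<i> * z)"

lemma cexp_add: "cexp (z + w) = cexp z * cexp w"
  by (simp add: cexp_def ring_distribs exp_add)

lemma cexp_int [simp]: "cexp (of_int n) = 1"
  unfolding cexp_def using exp_integer_2pi[of "of_int n"] by (simp add: mult_ac)

lemma cexp_1 [simp]: "cexp 1 = 1" and cexp_0 [simp]: "cexp 0 = 1"
  using cexp_int[of 1] cexp_int[of 0] by (simp_all del: cexp_int)

lemma cexp_minus: "cexp (- z) = inverse (cexp z)"
  by (simp add: cexp_def exp_minus)

lemma cexp_power: "cexp z ^ n = cexp (of_nat n * z)"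
  by (simp add: cexp_def exp_of_nat_mult[symmetric] mult_ac)

lemma cexp_nonzero [simp]: "cexp z \<noteq> 0"
  by (simp add: cexp_def)

lemma norm_cexp: "norm (cexp z) = exp (- 2 * pi * Im z)"
  by (simp add: cexp_def)

lemma norm_cexp_of_real [simp]: "norm (cexp (of_real x)) = 1"
  by (simp add: norm_cexp)

lemma cexp_eq_1_iff: "cexp z = 1 \<longleftrightarrow> z \<in> \<int>"
proof
  assume "cexp z = 1"
  then obtain n :: int where "Re (2 * of_real pi * \<i> * z) = 0" "Im (2 * of_real pi * \<i> * z) = of_int (2 * n) * pi"
    unfolding cexp_def exp_eq_1 by auto
  hence "z = of_int n" by (simp add: complex_eq_iff)
  thus "z \<in> \<int>" by simp
qed (auto elim!: Ints_cases)

lemma has_field_derivative_cexp [derivative_intros]: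
  assumes "(f has_field_derivative f') (at z within A)"
  shows "((\<lambda>z. cexp (f z)) has_field_derivative (2 * of_real pi * \<i> * f' * cexp (f z))) (at z within A)"
  unfolding cexp_def using assms by (auto intro!: derivative_eq_intros)

lemma holomorphic_on_cexp [holomorphic_intros]:
  "f holomorphic_on A \<Longrightarrow> (\<lambda>z. cexp (f z)) holomorphic_on A"
  unfolding cexp_def by (intro holomorphic_intros)

lemma continuous_on_cexp [continuous_intros]:
  "continuous_on A f \<Longrightarrow> continuous_on A (\<lambda>x. cexp (f x))"
  unfolding cexp_def by (intro continuous_intros)

text \<open>
  Chernoff's trick: with \<open>g z = (F z - F 0) / (cexp z - 1)\<close>, which is holomorphic near \<open>[0, 1]\<close>,
  the Fourier coefficients of \<open>F - F 0\<close> telescope.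
\<close>

lemma fourier_series_at_0:
  fixes F :: "complex \<Rightarrow> complex"
  assumes holo: "F holomorphic_on UNIV" and per: "F (0 + 1) = F 0" "deriv F 1 = deriv F 0"
  defines "c \<equiv> (\<lambda>k::int. integral {0..1} (\<lambda>x. F (of_real x) * cexp (- (of_int k * of_real x))))"
  shows "(\<lambda>N. \<Sum>k\<in>{-int N..int N}. c k) \<longlonglongrightarrow> F 0"
proof -
  \<comment> \<open>The open strip contains \<open>[0, 1]\<close>, and its only integers, hence the
    only zeros of \<open>cexp z - 1\<close> in it, are \<open>0\<close> and
    \<open>1\<close>.\<close>
  define S :: "complex set" where "S = {z. -1 < Re z} \<inter> {z. Re z < 2}"
  have S: "open S" unfolding S_def by (intro open_Int open_halfspace_Re_gt open_halfspace_Re_lt)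
  \<comment> \<open>The special value is the limit at both points by l'Hopital's rule, because
    \<open>F\<close> and \<open>deriv F\<close> each agree at \<open>0\<close> and
    \<open>1\<close>.\<close>
  define g where "g = (\<lambda>z. if z \<in> {0, 1} then deriv F 0 / (2 * of_real pi * \<i>) else (F z - F 0) / (cexp z - 1))"
  have ints: "z \<in> {0, 1}" if "z \<in> S" "cexp z = 1" for z
    using that by (auto simp: cexp_eq_1_iff S_def elim!: Ints_cases)
  have dF: "(F has_field_derivative deriv F z) (at z)" for z
    using holo holomorphic_derivI by blast
  have lim: "((\<lambda>z. (F z - F 0) / (cexp z - 1)) \<longlongrightarrow> deriv F 0 / (2 * of_real pi * \<i>)) (at z)" if "z \<in> {0, 1}" for z
  proof (rule lhopital_complex_simple)
    show "((\<lambda>z. F z - F 0) has_field_derivative deriv F 0) (at z)"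
      using dF[of z] that per by (auto intro!: derivative_eq_intros)
    show "((\<lambda>z. cexp z - 1) has_field_derivative (2 * of_real pi * \<i>)) (at z)"
      using that by (auto intro!: derivative_eq_intros)
  qed (use that per in auto)
  have g: "g holomorphic_on S"
  proof (rule no_isolated_singularity'[where K = "{0, 1}"])
    fix z :: complex assume z: "z \<in> {0, 1}"
    have "eventually (\<lambda>w. w \<notin> {0, 1} - {z}) (at z)"
      using islimpt_finite[of "{0,1} - {z}" z] by (simp add: islimpt_iff_eventually)
    hence "eventually (\<lambda>w. (F w - F 0) / (cexp w - 1) = g w) (at z)"
      using eventually_neq_at_within[of z z UNIV] by eventually_elim (auto simp: g_def)
    moreover have "g z = deriv F 0 / (2 * of_real pi * \<i>)" using z by (simp add: g_def)
    ultimately have "(g \<longlongrightarrow> g z) (at z)" using lim[OF z] Lim_transform_eventually by fastforce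
    thus "(g \<longlongrightarrow> g z) (at z within S)" using tendsto_within_subset by blast
  next
    have "(\<lambda>z. (F z - F 0) / (cexp z - 1)) holomorphic_on S - {0, 1}"
      using ints by (intro holomorphic_intros holomorphic_on_subset[OF holo]) fastforce+
    thus "g holomorphic_on S - {0, 1}" by (rule holomorphic_transform) (auto simp: g_def)
  qed (use S in auto)
  have in_S: "of_real x \<in> S" if "x \<in> {0..1}" for x
    using that by (auto simp: S_def)
  define d where "d = (\<lambda>k::int. integral {0..1} (\<lambda>x. g (of_real x) * cexp (- (of_int k * of_real x))))"
  have gF: "g z * (cexp z - 1) = F z - F 0" if "z \<in> S" for z
    using ints[OF that] per by (auto simp: g_def)
  have cont_g: "continuous_on {0..1} (\<lambda>x. g (of_real x))"
    by (rule continuous_on_compose2[OF holomorphic_on_imp_continuous_on[OF g]])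
       (use in_S in \<open>auto intro!: continuous_intros\<close>)
  have cont_g': "continuous_on {0..1} (\<lambda>x. deriv g (of_real x))"
    by (rule continuous_on_compose2[OF holomorphic_on_imp_continuous_on[OF holomorphic_deriv[OF g S]]])
       (use in_S in \<open>auto intro!: continuous_intros\<close>)
  have delta: "integral {0..1} (\<lambda>x. cexp (- (of_int k * of_real x))) = (if k = 0 then 1 else 0)" for k :: int
  proof (cases "k = 0")
    case False
    have "((\<lambda>x. cexp (- (of_int k * of_real x))) has_integral
        (cexp (- (of_int k * of_real 1)) / (- 2 * of_real pi * \<i> * of_int k)
           - cexp (- (of_int k * of_real 0)) / (- 2 * of_real pi * \<i> * of_int k))) {0..1}"
    proof (rule fundamental_theorem_of_calculus)
      fix x :: real
      have "((\<lambda>z. cexp (- (of_int k * z)) / (- 2 * of_real pi * \<i> * of_int k)) has_field_derivative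
              cexp (- (of_int k * of_real x))) (at (of_real x))"
        using False by (auto intro!: derivative_eq_intros simp: field_simps)
      from has_vector_derivative_real_field[OF this]
      show "((\<lambda>x. cexp (- (of_int k * of_real x)) / (- 2 * of_real pi * \<i> * of_int k))
         has_vector_derivative cexp (- (of_int k * of_real x))) (at x within {0..1})" .
    qed auto
    moreover have "cexp (- (of_int k)) = 1" using cexp_int[of "-k"] by simp
    ultimately show ?thesis using False by (simp add: integral_unique)
  qed auto
  \<comment> \<open>Multiplication by \<open>cexp z\<close> shifts the index of a Fourier
    coefficient by one, so \<open>F - F 0 = g * (cexp - 1)\<close> has the coefficients
    \<open>d (k - 1) - d k\<close>.\<close>
  have c_eq: "c k = F 0 * (if k = 0 then 1 else 0) + (d (k - 1) - d k)" for k
  proof -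
    have "c k = integral {0..1} (\<lambda>x. F 0 * cexp (- (of_int k * of_real x))
            + (g (of_real x) * cexp (- (of_int (k - 1) * of_real x)) - g (of_real x) * cexp (- (of_int k * of_real x))))"
      unfolding c_def
    proof (rule integral_cong)
      fix x :: real assume x: "x \<in> {0..1}"
      have e: "cexp (- (of_int (k - 1) * of_real x)) = cexp (of_real x) * cexp (- (of_int k * of_real x))"
        unfolding cexp_add[symmetric] by (simp add: algebra_simps)
      have Fx: "F (of_real x) = F 0 + g (of_real x) * (cexp (of_real x) - 1)"
        using gF[OF in_S[OF x]] by simp
      show "F (of_real x) * cexp (- (of_int k * of_real x)) = F 0 * cexp (- (of_int k * of_real x))
            + (g (of_real x) * cexp (- (of_int (k - 1) * of_real x)) - g (of_real x) * cexp (- (of_int k * of_real x)))"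
        unfolding e Fx by (simp add: algebra_simps)
    qed
    also have "\<dots> = F 0 * integral {0..1} (\<lambda>x. cexp (- (of_int k * of_real x))) + (d (k - 1) - d k)"
      unfolding d_def
      by (subst integral_add integral_diff integral_mult_right;
          (intro integrable_continuous_interval continuous_intros cont_g)?)+ simp
    finally show ?thesis by (simp only: delta)
  qed
  have sum_c: "(\<Sum>k\<in>{-int N..int N}. c k) = F 0 + (d (- 1 - int N) - d (int N))" for N
  proof (induction N)
    case (Suc N)
    have "{-int (Suc N)..int (Suc N)} = insert (- int (Suc N)) (insert (int (Suc N)) {-int N..int N})" by auto
    thus ?case using Suc by (simp add: c_eq algebra_simps)
  qed (simp add: c_eq)
  obtain B where B: "\<And>x. x \<in> {0..1} \<Longrightarrow> norm (deriv g (of_real x)) \<le> B"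
    using compact_imp_bounded[OF compact_continuous_image[OF cont_g' compact_Icc]]
    unfolding bounded_iff by (metis imageI)
  \<comment> \<open>Integration by parts: the boundary terms cancel because
    \<open>g 0 = g 1\<close>, which leaves decay of order \<open>1 / k\<close>.\<close>
  have d_bound: "norm (d k) \<le> B / (2 * pi * \<bar>of_int k\<bar>)" if "k \<noteq> 0" for k
  proof -
    let ?e = "\<lambda>x. cexp (- (of_int k * of_real x))"
    have int1: "(\<lambda>x. deriv g (of_real x) * ?e x) integrable_on {0..1}"
      by (intro integrable_continuous_interval continuous_intros cont_g')
    have int2: "(\<lambda>x. g (of_real x) * ?e x) integrable_on {0..1}"
      by (intro integrable_continuous_interval continuous_intros cont_g)
    have "((\<lambda>x. deriv g (of_real x) * ?e x - (2 * of_real pi * \<i> * of_int k) * (g (of_real x) * ?e x)) has_integral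
        (g (of_real 1) * ?e 1 - g (of_real 0) * ?e 0)) {0..1}"
    proof (rule fundamental_theorem_of_calculus)
      fix x :: real assume x: "x \<in> {0..1}"
      have "(g has_field_derivative deriv g (of_real x)) (at (of_real x))"
        using g S in_S[OF x] holomorphic_derivI by blast
      hence "((\<lambda>z. g z * cexp (- (of_int k * z))) has_field_derivative
         deriv g (of_real x) * ?e x - (2 * of_real pi * \<i> * of_int k) * (g (of_real x) * ?e x)) (at (of_real x))"
        by (auto intro!: derivative_eq_intros simp: algebra_simps)
      from has_vector_derivative_real_field[OF this]
      show "((\<lambda>x. g (of_real x) * ?e x) has_vector_derivative
         deriv g (of_real x) * ?e x - (2 * of_real pi * \<i> * of_int k) * (g (of_real x) * ?e x)) (at x within {0..1})" .
    qed auto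
    moreover have "g (of_real 1) * ?e 1 - g (of_real 0) * ?e 0 = 0"
      using cexp_int[of "-k"] by (simp add: g_def)
    ultimately have "integral {0..1} (\<lambda>x. deriv g (of_real x) * ?e x - (2 * of_real pi * \<i> * of_int k) * (g (of_real x) * ?e x)) = 0"
      by (simp add: integral_unique)
    also have "integral {0..1} (\<lambda>x. deriv g (of_real x) * ?e x - (2 * of_real pi * \<i> * of_int k) * (g (of_real x) * ?e x))
       = integral {0..1} (\<lambda>x. deriv g (of_real x) * ?e x) - (2 * of_real pi * \<i> * of_int k) * d k"
      unfolding d_def using int1 int2 by (subst integral_diff) (auto intro: integrable_on_mult_right)
    finally have "d k = integral {0..1} (\<lambda>x. deriv g (of_real x) * ?e x) / (2 * of_real pi * \<i> * of_int k)"
      using that by (simp add: field_simps)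
    moreover have "norm (integral {0..1} (\<lambda>x. deriv g (of_real x) * ?e x)) \<le> B * (1 - 0)"
    proof (rule integral_bound)
      fix x :: real assume x: "x \<in> {0..1}"
      have "norm (?e x) = 1" using norm_cexp_of_real[of "- (of_int k * x)"] by simp
      thus "norm (deriv g (of_real x) * ?e x) \<le> B" using B[OF x] by (simp add: norm_mult)
    qed (auto intro!: continuous_intros cont_g')
    ultimately show ?thesis by (simp add: norm_divide norm_mult divide_right_mono)
  qed
  have lim1: "(\<lambda>N. B / (2 * pi) * inverse (real (Suc N))) \<longlonglongrightarrow> 0"
    by (intro tendsto_mult_right_zero LIMSEQ_inverse_real_of_nat)
  have "(\<lambda>N. d (- 1 - int N)) \<longlonglongrightarrow> 0"
  proof (rule Lim_null_comparison[OF _ lim1], rule always_eventually, rule allI)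
    fix N show "norm (d (- 1 - int N)) \<le> B / (2 * pi) * inverse (real (Suc N))"
      using d_bound[of "- 1 - int N"] by (simp add: field_simps abs_if)
  qed
  moreover have "(\<lambda>N. d (int (Suc N))) \<longlonglongrightarrow> 0"
  proof (rule Lim_null_comparison[OF _ lim1], rule always_eventually, rule allI)
    fix N show "norm (d (int (Suc N))) \<le> B / (2 * pi) * inverse (real (Suc N))"
      using d_bound[of "int (Suc N)"] by (simp add: field_simps abs_if)
  qed
  hence "(\<lambda>N. d (int N)) \<longlonglongrightarrow> 0" by (rule LIMSEQ_imp_Suc)
  ultimately have "(\<lambda>N. F 0 + (d (- 1 - int N) - d (int N))) \<longlonglongrightarrow> F 0 + (0 - 0)"
    by (intro tendsto_intros)
  thus ?thesis by (simp add: sum_c)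
qed

section \<open>Poisson summation for the Gaussian\<close>

text \<open>Completing a square bounds \<open>Re ((z + n)^2) = (Re z + n)^2 - (Im z)^2\<close> from
  below by \<open>\<bar>n\<bar>\<close> minus a constant depending on \<open>R\<close>. The
  resulting geometric majorant is uniform on discs, as the M-test requires.\<close>

lemma norm_gauss_bound:
  fixes z :: complex and n :: int
  assumes s: "s > 0" and z: "norm z \<le> R"
  shows "norm (exp (- of_real (pi * s) * (z + of_int n) ^ 2)) \<le>
           exp (pi * s * ((2 * R + 1) ^ 2 / 4 + R ^ 2)) * exp (- pi * s) ^ nat \<bar>n\<bar>"
proof -
  define m where "m = \<bar>real_of_int n\<bar>"
  have R: "\<bar>Re z\<bar> \<le> R" "\<bar>Im z\<bar> \<le> R" using z abs_Re_le_cmod abs_Im_le_cmod order_trans by blast+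
  have "(Im z)^2 \<le> R^2" using R(2) by (metis abs_ge_zero abs_le_square_iff abs_of_nonneg order_trans)
  moreover have "\<bar>Re z * real_of_int n\<bar> \<le> R * m"
    unfolding abs_mult m_def using R by (intro mult_mono) auto
  moreover have "m\<^sup>2 = (real_of_int n)^2" by (simp add: m_def)
  moreover have "0 \<le> (m - (2 * R + 1) / 2)^2" by simp
  moreover have "(m - (2 * R + 1) / 2)^2 = m ^ 2 - m - 2 * (R * m) + (2 * R + 1) ^ 2 / 4"
    by (simp add: power2_eq_square field_simps)
  moreover have "(Re z + n) ^ 2 = (Re z)^2 + 2 * (Re z * n) + (real_of_int n)^2"
    by (simp add: power2_sum)
  moreover have "0 \<le> (Re z)^2" by simp
  ultimately have "m - ((2 * R + 1) ^ 2 / 4 + R ^ 2) \<le> (Re z + n) ^ 2 - (Im z) ^ 2"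
    unfolding abs_le_iff by linarith
  also have "\<dots> = Re ((z + of_int n) ^ 2)" by (simp add: Re_power2)
  finally have "pi * s * (m - ((2 * R + 1) ^ 2 / 4 + R ^ 2)) \<le> pi * s * Re ((z + of_int n) ^ 2)"
    using s by (intro mult_left_mono) auto
  hence "- (pi * s * Re ((z + of_int n) ^ 2)) \<le> pi * s * ((2 * R + 1) ^ 2 / 4 + R ^ 2) + real (nat \<bar>n\<bar>) * (- pi * s)"
    by (simp add: m_def algebra_simps)
  hence "exp (- (pi * s * Re ((z + of_int n) ^ 2))) \<le> exp (pi * s * ((2 * R + 1) ^ 2 / 4 + R ^ 2) + real (nat \<bar>n\<bar>) * (- pi * s))"
    by (simp only: exp_le_cancel_iff)
  also have "\<dots> = exp (pi * s * ((2 * R + 1) ^ 2 / 4 + R ^ 2)) * exp (- pi * s) ^ nat \<bar>n\<bar>"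
    unfolding exp_add exp_of_nat_mult ..
  also have "- (pi * s * Re ((z + of_int n) ^ 2)) = Re (- of_real (pi * s) * (z + of_int n) ^ 2)"
    by (simp del: of_real_mult)
  finally show ?thesis by (simp only: norm_exp_eq_Re)
qed

lemma summable_on_gauss_bound:
  assumes "s > 0"
  shows "(\<lambda>n::int. C * exp (- pi * s) ^ nat \<bar>n\<bar>) summable_on UNIV"
  using assms by (intro summable_on_cmult_right summable_on_geometric_int) auto

text \<open>The Fourier transform of the Gaussian is read off from the characteristic function of
  the standard normal distribution by rescaling.\<close>

lemma gauss_fourier:
  fixes s a :: real
  assumes s: "s > 0"
  defines "h \<equiv> (\<lambda>x::real. exp (- of_real (pi * s) * of_real x ^ 2) * cexp (- (of_real a * of_real x)))"
  shows "integrable lborel h" and "integral\<^sup>L lborel h = of_real (exp (- pi * a ^ 2 / s) / sqrt s)"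
proof -
  \<comment> \<open>With these constants \<open>(c * x)^2 / 2 = pi * s * x^2\<close> and
    \<open>t * (c * x) = - 2 * pi * a * x\<close>.\<close>
  define c where "c = sqrt (2 * pi * s)"
  define t where "t = - 2 * pi * a / c"
  have c: "c > 0" "c ^ 2 = 2 * pi * s" using s by (auto simp: c_def)
  interpret real_distribution std_normal_distribution by (rule real_dist_normal_dist)
  define f where "f = (\<lambda>x. std_normal_density x *\<^sub>R iexp (t * x))"
  have "integrable std_normal_distribution (\<lambda>x. iexp (t * x))"
    by (intro integrable_const_bound) auto
  hence int_f: "integrable lborel f" unfolding f_def
    by (subst (asm) integrable_density) auto
  have "char std_normal_distribution t = integral\<^sup>L lborel f"
    unfolding char_def f_def by (subst integral_density) auto
  hence f: "integral\<^sup>L lborel f = of_real (exp (- (t^2) / 2))" by (simp add: char_std_normal_distribution)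
  have fh: "f (0 + c * x) = of_real (1 / sqrt (2 * pi)) * h x" for x
  proof -
    have "iexp (t * (c * x)) = cexp (- (of_real a * of_real x))"
      using c by (simp add: cexp_def t_def mult_ac)
    moreover have "- ((c * x)^2) / 2 = - (pi * s) * x^2"
      by (simp add: power_mult_distrib c)
    hence "std_normal_density (c * x) = 1 / sqrt (2 * pi) * exp (- (pi * s) * x^2)"
      by (simp add: normal_density_def)
    hence "complex_of_real (std_normal_density (c * x)) = of_real (1 / sqrt (2 * pi)) * exp (- of_real (pi * s) * of_real x ^ 2)"
      by (simp add: exp_of_real[symmetric])
    ultimately show ?thesis by (simp add: f_def h_def scaleR_conv_of_real)
  qed
  have h: "h = (\<lambda>x. of_real (sqrt (2 * pi)) * f (0 + c * x))"
    unfolding fh by (auto simp: fun_eq_iff simp flip: of_real_mult)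
  show "integrable lborel h" unfolding h
    using c by (intro integrable_mult_right lborel_integrable_real_affine int_f) auto
  have "integral\<^sup>L lborel f = c *\<^sub>R (LINT x|lborel. f (0 + c * x))"
    using lborel_integral_real_affine[of c f 0] c by simp
  hence "(LINT x|lborel. f (0 + c * x)) = of_real (exp (- (t^2) / 2)) / of_real c"
    using f c by (simp add: field_simps scaleR_conv_of_real)
  hence "integral\<^sup>L lborel h = of_real (sqrt (2 * pi)) * (of_real (exp (- (t^2) / 2)) / of_real c)"
    unfolding h by (subst integral_mult_right_zero) (simp only:)
  also have "t ^ 2 / 2 = pi * a ^ 2 / s"
    using s by (simp add: t_def power_divide c power_mult_distrib) (simp add: power2_eq_square field_simps)
  hence "- (t ^ 2) / 2 = - pi * a ^ 2 / s" by simp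
  also have "of_real (sqrt (2 * pi)) * (of_real (exp (- pi * a ^ 2 / s)) / of_real c) =
      complex_of_real (exp (- pi * a ^ 2 / s) / sqrt s)"
    using s by (simp add: c_def real_sqrt_mult)
  finally show "integral\<^sup>L lborel h = of_real (exp (- pi * a ^ 2 / s) / sqrt s)" .
qed

lemma integral_int_steps:
  fixes h :: "real \<Rightarrow> 'a::banach"
  assumes "continuous_on UNIV h"
  shows "(\<Sum>n\<in>{-int N..int N}. integral {c + of_int n..c + of_int n + 1} h) = integral {c - real N..c + real N + 1} h"
proof (induction N)
  case (Suc N)
  have i: "h integrable_on {a..b}" for a b
    by (intro integrable_continuous_interval continuous_on_subset[OF assms]) auto
  have "{-int (Suc N)..int (Suc N)} = insert (- int (Suc N)) (insert (int (Suc N)) {-int N..int N})" by auto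
  hence "(\<Sum>n\<in>{-int (Suc N)..int (Suc N)}. integral {c + of_int n..c + of_int n + 1} h) =
     integral {c - (real N + 1)..c - real N} h + integral {c + real N + 1..c + real N + 2} h + integral {c - real N..c + real N + 1} h"
    using Suc by (simp add: algebra_simps)
  also have "\<dots> = integral {c - (real N + 1)..c - real N} h + integral {c - real N..c + real N + 2} h"
    using Henstock_Kurzweil_Integration.integral_combine[OF _ _ i, of "c - real N" "c + real N + 1" "c + real N + 2"]
    by (simp add: add_ac)
  also have "\<dots> = integral {c - (real N + 1)..c + real N + 2} h"
    using Henstock_Kurzweil_Integration.integral_combine[OF _ _ i, of "c - (real N + 1)" "c - real N" "c + real N + 2"] by simp
  finally show ?case by (simp add: algebra_simps)
qed auto

text \<open>Dominated convergence with majorant \<open>norm (h x)\<close> reassembles the integral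
  over the line from unit intervals.\<close>

lemma tendsto_integral_int_steps:
  fixes h :: "real \<Rightarrow> complex"
  assumes "continuous_on UNIV h" "integrable lborel h"
  shows "(\<lambda>N. \<Sum>n\<in>{-int N..int N}. integral {c + of_int n..c + of_int n + 1} h) \<longlonglongrightarrow> integral\<^sup>L lborel h"
proof -
  have [measurable]: "h \<in> borel_measurable borel" using assms(2) by auto
  have eq: "integral {a..b} h = (LINT x|lborel. indicator {a..b} x *\<^sub>R h x)" for a b :: real
  proof -
    have "set_integrable lborel {a..b} h"
      unfolding set_integrable_def using assms(2) by (intro integrable_mult_indicator) auto
    from set_borel_integral_eq_integral(2)[OF this] show ?thesis by (simp add: set_lebesgue_integral_def)
  qed
  have "(\<lambda>N. LINT x|lborel. indicator {c - real N..c + real N + 1} x *\<^sub>R h x) \<longlonglongrightarrow> integral\<^sup>L lborel h"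
  proof (rule integral_dominated_convergence[where w = "\<lambda>x. norm (h x)"])
    show "AE x in lborel. (\<lambda>N. indicator {c - real N..c + real N + 1} x *\<^sub>R h x) \<longlonglongrightarrow> h x"
    proof (rule AE_I2)
      fix x :: real
      have "\<forall>\<^sub>F N in sequentially. real N \<ge> \<bar>x\<bar> + \<bar>c\<bar>"
        using filterlim_real_sequentially unfolding filterlim_at_top by blast
      hence "\<forall>\<^sub>F N in sequentially. indicator {c - real N..c + real N + 1} x *\<^sub>R h x = h x"
        by eventually_elim (auto simp: indicator_def)
      thus "(\<lambda>N. indicator {c - real N..c + real N + 1} x *\<^sub>R h x) \<longlonglongrightarrow> h x"
        by (rule tendsto_eventually)
    qed
    show "integrable lborel (\<lambda>x. norm (h x))" using assms(2) by auto
  qed (auto simp: indicator_def)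
  thus ?thesis unfolding integral_int_steps[OF assms(1)] unfolding eq .
qed

text \<open>Unfolding: the \<open>k\<close>-th Fourier coefficient of the periodised Gaussian is the
  Fourier transform of a single Gaussian at \<open>k\<close>. The shift \<open>x0\<close> is kept
  because the eta series leads to sums over shifted integers.\<close>

lemma poisson_gauss:
  fixes s x0 :: real
  assumes s: "s > 0"
  defines "G \<equiv> (\<Sum>\<^sub>\<infinity>n::int. exp (- of_real (pi * s) * (of_real x0 + of_int n) ^ 2) :: complex)"
  shows "((\<lambda>k::int. of_real (exp (- pi * of_int k ^ 2 / s)) * cexp (of_int k * of_real x0)) has_sum of_real (sqrt s) * G) UNIV"
proof -
  \<comment> \<open>The shift is made part of the function, so that the Fourier series is needed
    only at \<open>0\<close>.\<close>
  define f where "f = (\<lambda>n z. exp (- of_real (pi * s) * (z + of_real x0 + of_int n) ^ 2) :: complex)"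
  define F where "F = (\<lambda>z. \<Sum>\<^sub>\<infinity>n::int. f n z)"
  have bound: "norm (f n z) \<le> exp (pi * s * ((2 * (R + \<bar>x0\<bar>) + 1) ^ 2 / 4 + (R + \<bar>x0\<bar>) ^ 2)) * exp (- pi * s) ^ nat \<bar>n\<bar>"
    if "norm z \<le> R" for n z R
  proof -
    have "norm (z + of_real x0) \<le> R + \<bar>x0\<bar>" using that norm_triangle_ineq[of z "of_real x0"] by simp
    thus ?thesis unfolding f_def by (rule norm_gauss_bound[OF s])
  qed
  have holo: "F holomorphic_on UNIV" unfolding F_def
  proof (rule holomorphic_on_infsum)
    fix z :: complex
    have "norm w \<le> norm z + 1" if "w \<in> cball z 1" for w
      using that norm_triangle_ineq[of z "w - z"] by (simp add: dist_norm norm_minus_commute)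
    thus "\<exists>r>0. \<exists>M. cball z r \<subseteq> UNIV \<and> M summable_on UNIV \<and> (\<forall>n\<in>UNIV. \<forall>w\<in>cball z r. cmod (f n w) \<le> M n)"
      by (intro exI[of _ 1] conjI exI[of _ "\<lambda>n. exp (pi * s * ((2 * (norm z + 1 + \<bar>x0\<bar>) + 1) ^ 2 / 4 + (norm z + 1 + \<bar>x0\<bar>) ^ 2)) * exp (- pi * s) ^ nat \<bar>n\<bar>"]
           summable_on_gauss_bound s ballI bound) auto
  qed (auto simp: f_def intro!: holomorphic_intros)
  have per: "F (z + 1) = F z" for z
  proof -
    have "F (z + 1) = (\<Sum>\<^sub>\<infinity>n. f (n + 1) z)" unfolding F_def f_def by (simp add: add_ac)
    also have "\<dots> = F z" unfolding F_def
      by (rule infsum_reindex_bij_betw[where f = "\<lambda>n. f n z"])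
         (rule bij_betw_byWitness[where f' = "\<lambda>n. n - 1"], auto)
    finally show ?thesis .
  qed
  have per': "deriv F 1 = deriv F 0"
  proof -
    have "(F has_field_derivative deriv F 1) (at (0 + 1))"
      using holo holomorphic_derivI[of F UNIV 1] by simp
    hence "((\<lambda>z. F (z + 1)) has_field_derivative deriv F 1) (at 0)" by (simp only: DERIV_shift)
    thus ?thesis unfolding per by (metis DERIV_imp_deriv)
  qed
  define c where "c = (\<lambda>k::int. integral {0..1} (\<lambda>x. F (of_real x) * cexp (- (of_int k * of_real x))))"
  have c: "c k = of_real (exp (- pi * of_int k ^ 2 / s)) * cexp (of_int k * of_real x0) / of_real (sqrt s)" for k
  proof -
    define h where "h = (\<lambda>x::real. exp (- of_real (pi * s) * of_real x ^ 2) * cexp (- (of_real (of_int k) * of_real x)))"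
    have h: "integrable lborel h" "integral\<^sup>L lborel h = of_real (exp (- pi * of_int k ^ 2 / s) / sqrt s)"
      unfolding h_def by (intro gauss_fourier s)+
    have cont_h: "continuous_on UNIV h" unfolding h_def by (intro continuous_intros)
    let ?e = "\<lambda>x. cexp (- (of_int k * of_real x))"
    \<comment> \<open>Uniform convergence on \<open>[0, 1]\<close> allows sum and integral to be
      interchanged.\<close>
    have ul: "uniform_limit {0..1::real} (\<lambda>X x. \<Sum>n\<in>X. f n (of_real x) * ?e x) (\<lambda>x. \<Sum>\<^sub>\<infinity>n. f n (of_real x) * ?e x) (finite_subsets_at_top UNIV)"
    proof (rule Weierstrass_m_test_general[OF _ summable_on_gauss_bound[OF s]])
      fix n :: int and x :: real assume x: "x \<in> {0..1}"
      have "norm (?e x) = 1" using norm_cexp_of_real[of "- (of_int k * x)"] by simp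
      thus "norm (f n (of_real x) * ?e x) \<le> exp (pi * s * ((2 * (1 + \<bar>x0\<bar>) + 1) ^ 2 / 4 + (1 + \<bar>x0\<bar>) ^ 2)) * exp (- pi * s) ^ nat \<bar>n\<bar>"
        unfolding norm_mult using bound[of "of_real x" 1 n] x by simp
    qed
    have cont_f: "continuous_on A (\<lambda>x::real. f n (of_real x) * ?e x)" for n A
      unfolding f_def by (intro continuous_intros)
    obtain I J where IJ: "\<And>X. ((\<lambda>x. \<Sum>n\<in>X. f n (of_real x) * ?e x) has_integral I X) {0..1}"
        "((\<lambda>x. \<Sum>\<^sub>\<infinity>n. f n (of_real x) * ?e x) has_integral J) {0..1}" "(I \<longlongrightarrow> J) (finite_subsets_at_top UNIV)"
      by (rule uniform_limit_integral[OF ul]) (auto intro!: continuous_on_sum cont_f)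
    have "I X = (\<Sum>n\<in>X. integral {0..1} (\<lambda>x. f n (of_real x) * ?e x))" if "finite X" for X
      using integral_unique[OF IJ(1)[of X]] that
      by (subst (asm) integral_sum) (auto intro!: integrable_continuous_interval cont_f)
    hence "((\<lambda>n. integral {0..1} (\<lambda>x. f n (of_real x) * ?e x)) has_sum J) UNIV"
      unfolding has_sum_def
      by (intro Lim_transform_eventually[OF IJ(3)] eventually_finite_subsets_at_top_weakI)
    also have "(\<lambda>n. integral {0..1} (\<lambda>x. f n (of_real x) * ?e x)) =
        (\<lambda>n. cexp (of_int k * of_real x0) * integral {x0 + of_int n..x0 + of_int n + 1} h)"
    proof
      fix n :: int
      \<comment> \<open>\<open>cexp\<close> is unaffected by the integer \<open>k * n\<close>, so
        every summand becomes an integral of the same \<open>h\<close> over a translate of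
        \<open>[0, 1]\<close>.\<close>
      have e: "?e x = cexp (of_int k * of_real x0) * cexp (- (of_int k * of_real (x0 + of_int n + x)))" for x :: real
      proof -
        have "cexp (of_int k * of_real x0) * cexp (- (of_int k * of_real (x0 + of_int n + x))) = cexp (- (of_int k * of_real x)) * cexp (of_int (- (k * n)))"
          unfolding cexp_add[symmetric] by (simp add: algebra_simps)
        thus ?thesis unfolding cexp_int by simp
      qed
      have "(\<lambda>x. f n (of_real x) * ?e x) = (\<lambda>x. cexp (of_int k * of_real x0) * (h \<circ> (+) (x0 + of_int n)) x)"
      proof
        fix x :: real
        show "f n (of_real x) * ?e x = cexp (of_int k * of_real x0) * (h \<circ> (+) (x0 + of_int n)) x"
          unfolding f_def h_def o_def by (subst e) (simp add: add_ac mult_ac)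
      qed
      thus "integral {0..1} (\<lambda>x. f n (of_real x) * ?e x) = cexp (of_int k * of_real x0) * integral {x0 + of_int n..x0 + of_int n + 1} h"
        by (simp only: integral_mult_right integral_shift_Icc_real) (simp add: add_ac)
    qed
    finally have "(\<lambda>N. \<Sum>n\<in>{-int N..int N}. cexp (of_int k * of_real x0) * integral {x0 + of_int n..x0 + of_int n + 1} h) \<longlonglongrightarrow> J"
      by (rule has_sum_int_symmetric)
    moreover have "(\<lambda>N. \<Sum>n\<in>{-int N..int N}. cexp (of_int k * of_real x0) * integral {x0 + of_int n..x0 + of_int n + 1} h) \<longlonglongrightarrow> cexp (of_int k * of_real x0) * integral\<^sup>L lborel h"
      unfolding sum_distrib_left[symmetric] by (intro tendsto_intros tendsto_integral_int_steps cont_h h)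
    ultimately have "J = cexp (of_int k * of_real x0) * integral\<^sup>L lborel h" by (rule LIMSEQ_unique)
    moreover have "c k = J"
    proof -
      have "(\<lambda>x. F (of_real x) * ?e x) = (\<lambda>x. \<Sum>\<^sub>\<infinity>n. f n (of_real x) * ?e x)"
        unfolding F_def by (simp add: infsum_cmult_left')
      thus ?thesis unfolding c_def using IJ(2) by (simp add: integral_unique)
    qed
    ultimately show ?thesis by (simp add: h)
  qed
  have lim: "(\<lambda>N. \<Sum>k\<in>{-int N..int N}. c k) \<longlonglongrightarrow> F 0"
    unfolding c_def using per[of 0] per' by (intro fourier_series_at_0 holo) auto
  \<comment> \<open>Fourier inversion controls only symmetric partial sums; absolute summability of
    the coefficients upgrades this to an unordered sum.\<close>
  have "c summable_on UNIV"
  proof -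
    have "(\<lambda>k. norm (c k)) summable_on UNIV"
    proof (rule Infinite_Sum.abs_summable_on_comparison_test'[OF summable_on_gauss_bound])
      show "1 / s > 0" using s by simp
      fix k :: int
      have "norm (cexp (of_int k * of_real x0)) = 1" using norm_cexp_of_real[of "of_int k * x0"] by simp
      hence "norm (c k) = exp (- pi * of_int k ^ 2 / s) / sqrt s" using s by (simp add: c norm_mult norm_divide)
      also have "exp (- pi * of_int k ^ 2 / s) = norm (exp (- of_real (pi * (1 / s)) * (0 + of_int k) ^ 2) :: complex)"
        by (simp add: norm_exp_eq_Re)
      also have "\<dots> / sqrt s \<le> exp (pi * (1 / s) * ((2 * 0 + 1) ^ 2 / 4 + 0 ^ 2)) * exp (- pi * (1 / s)) ^ nat \<bar>k\<bar> / sqrt s"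
        using s by (intro divide_right_mono norm_gauss_bound) auto
      finally show "norm (c k) \<le> (exp (pi * (1 / s) * ((2 * 0 + 1) ^ 2 / 4 + 0 ^ 2)) / sqrt s) * exp (- pi * (1 / s)) ^ nat \<bar>k\<bar>"
        by simp
    qed
    thus ?thesis by (rule abs_summable_summable)
  qed
  hence "(c has_sum infsum c UNIV) UNIV" by (rule has_sum_infsum)
  moreover from has_sum_int_symmetric[OF this] lim have "infsum c UNIV = F 0" by (rule LIMSEQ_unique)
  ultimately have "(c has_sum F 0) UNIV" by simp
  hence "((\<lambda>k. of_real (sqrt s) * c k) has_sum of_real (sqrt s) * F 0) UNIV" by (rule has_sum_cmult_right)
  moreover have "F 0 = G" by (simp add: F_def G_def f_def)
  moreover have "of_real (sqrt s) * c k = of_real (exp (- pi * of_int k ^ 2 / s)) * cexp (of_int k * of_real x0)" for k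
    using s by (simp add: c)
  ultimately show ?thesis by simp
qed

section \<open>Inversion of the eta function\<close>

lemma infsum_int_mod:
  fixes f :: "int \<Rightarrow> 'a::banach"
  assumes "f summable_on UNIV" "m > 0"
  shows "(\<Sum>\<^sub>\<infinity>n. f n) = (\<Sum>r\<in>{0..<m}. \<Sum>\<^sub>\<infinity>n. f (m * n + r))"
proof -
  have bij: "bij_betw (\<lambda>(r, n). m * n + r) (Sigma {0..<m} (\<lambda>_. UNIV)) UNIV"
    using assms(2) by (intro bij_betw_byWitness[where f' = "\<lambda>k. (k mod m, k div m)"]) auto
  have "(\<lambda>x. f ((\<lambda>(r, n). m * n + r) x)) summable_on (Sigma {0..<m} (\<lambda>_. UNIV))"
    using assms(1) unfolding summable_on_reindex_bij_betw[OF bij] .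
  from infsum_Sigma_banach[OF this]
  have "(\<Sum>\<^sub>\<infinity>r\<in>{0..<m}. \<Sum>\<^sub>\<infinity>n. f (m * n + r)) = infsum f UNIV"
    unfolding infsum_reindex_bij_betw[OF bij] by simp
  thus ?thesis by simp
qed

text \<open>Taking \<open>q^(1/24)\<close> as \<open>cexp (\<tau> / 24)\<close> makes it
  single-valued in \<tau>.\<close>

definition dedekind_eta :: "complex \<Rightarrow> complex" where
  "dedekind_eta \<tau> = cexp (\<tau> / 24) * f_minus (cexp \<tau>)"

lemma norm_cexp_less_1: "Im \<tau> > 0 \<Longrightarrow> norm (cexp \<tau>) < 1"
  by (simp add: norm_cexp)

lemma dedekind_eta_nonzero: "Im \<tau> > 0 \<Longrightarrow> dedekind_eta \<tau> \<noteq> 0"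
  by (simp add: dedekind_eta_def f_minus_nonzero norm_cexp_less_1)

lemma holomorphic_dedekind_eta [holomorphic_intros]:
  assumes "g holomorphic_on A" "\<And>z. z \<in> A \<Longrightarrow> Im (g z) > 0"
  shows "(\<lambda>z. dedekind_eta (g z)) holomorphic_on A"
proof -
  have "f_minus \<circ> (\<lambda>z. cexp (g z)) holomorphic_on A"
    by (rule holomorphic_on_compose_gen[OF _ holomorphic_f_minus])
       (use assms norm_cexp_less_1 in \<open>auto intro!: holomorphic_intros\<close>)
  thus ?thesis unfolding dedekind_eta_def o_def using assms(1) by (intro holomorphic_intros) auto
qed

lemma dedekind_eta_translate: "dedekind_eta (\<tau> + of_int m) = cexp (of_int m / 24) * dedekind_eta \<tau>"
  by (simp add: dedekind_eta_def cexp_add add_divide_distrib)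

text \<open>The factor \<open>q^(1/24)\<close> completes the square:
  \<open>n (3 n - 1) / 2 + 1 / 24 = (3 / 2) (n - 1 / 6)^2\<close>.\<close>

lemma dedekind_eta_imaginary:
  assumes t: "t > 0"
  shows "((\<lambda>n::int. (-1) powi n * exp (- of_real (3 * pi * t) * (of_int n - 1 / 6) ^ 2))
           has_sum dedekind_eta (\<i> * of_real t)) UNIV"
proof -
  have "((\<lambda>n::int. cexp (\<i> * of_real t / 24) * ((-1) powi n * cexp (\<i> * of_real t) ^ pent n))
           has_sum dedekind_eta (\<i> * of_real t)) UNIV"
    unfolding dedekind_eta_def using t
    by (intro has_sum_cmult_right f_minus_has_sum norm_cexp_less_1) auto
  also have "(\<lambda>n::int. cexp (\<i> * of_real t / 24) * ((-1) powi n * cexp (\<i> * of_real t) ^ pent n)) =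
     (\<lambda>n. (-1) powi n * exp (- of_real (3 * pi * t) * (of_int n - 1 / 6) ^ 2))"
  proof
    fix n :: int
    have "2 * complex_of_nat (pent n) = of_int (2 * int (pent n))" by simp
    also have "\<dots> = of_int n * (3 * of_int n - 1)" unfolding pent_double by simp
    finally have p: "complex_of_nat (pent n) = of_int n * (3 * of_int n - 1) / 2"
      by (metis nonzero_mult_div_cancel_left zero_neq_numeral)
    have "cexp (\<i> * of_real t / 24) * cexp (\<i> * of_real t) ^ pent n = cexp (\<i> * of_real t / 24 + of_nat (pent n) * (\<i> * of_real t))"
      by (simp add: cexp_power cexp_add)
    also have "\<dots> = exp (- of_real (3 * pi * t) * (of_int n - 1 / 6) ^ 2)"
      unfolding cexp_def p by (rule arg_cong[of _ _ exp]) (simp add: field_simps power2_eq_square)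
    finally show "cexp (\<i> * of_real t / 24) * ((-1) powi n * cexp (\<i> * of_real t) ^ pent n) =
      (-1) powi n * exp (- of_real (3 * pi * t) * (of_int n - 1 / 6) ^ 2)"
      by (simp add: mult_ac)
  qed
  finally show ?thesis .
qed

lemma minus_one_powi_even [simp]: "(-1::complex) powi (2 * n) = 1"
  by (simp add: power_int_mult)

lemma cexp_half [simp]: "cexp (1 / 2) = -1"
  using exp_pi_i' by (simp add: cexp_def mult_ac)

lemma cexp_half_int: "cexp (of_int n / 2) = (-1) powi n"
proof (cases "even n")
  case True
  then obtain m where "n = 2 * m" by (elim evenE)
  thus ?thesis by simp
next
  case False
  then obtain m where m: "n = 2 * m + 1" by (elim oddE)
  have "cexp (of_int n / 2) = cexp (of_int m) * cexp (1 / 2)"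
    unfolding cexp_add[symmetric] m by (simp add: field_simps)
  also have "\<dots> = (-1) powi n" unfolding m by (simp add: power_int_add)
  finally show ?thesis .
qed

lemma cexp_twelfth: "cexp (1 / 12) + cexp (- 1 / 12) = of_real (sqrt 3)"
proof -
  have "cexp (1 / 12) = cis (pi / 6)" "cexp (- 1 / 12) = cis (- (pi / 6))"
    by (simp_all add: cexp_def cis_conv_exp mult_ac)
  thus ?thesis by (simp add: complex_eq_iff cos_30 flip: cis_cnj)
qed

text \<open>Splitting by the parity of \<open>n\<close> gives two shifted Gaussian sums. After
  Poisson summation the dual index \<open>k\<close> is sorted modulo 6: the even classes vanish, the
  class of 3 cancels in pairs \<open>k\<close>, \<open>-k\<close>, and the classes of 1 and 5 each
  reproduce eta at \<open>\<i> / t\<close>.\<close>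

lemma dedekind_eta_inversion_imaginary:
  assumes t: "t > 0"
  shows "dedekind_eta (\<i> / of_real t) = of_real (sqrt t) * dedekind_eta (\<i> * of_real t)"
proof -
  \<comment> \<open>Writing \<open>n\<close> as \<open>2 m\<close> or \<open>2 m + 1\<close> pulls a
    factor \<open>4\<close> out of the square, which turns \<open>3 * t\<close> into
    \<open>12 * t\<close>.\<close>
  define s where "s = 12 * t"
  have s: "s > 0" using t by (simp add: s_def)
  define A where "A = (\<lambda>x::real. \<Sum>\<^sub>\<infinity>n::int. exp (- of_real (pi * s) * (of_real x + of_int n) ^ 2) :: complex)"
  define E where "E = (\<lambda>t n. (-1) powi n * exp (- of_real (3 * pi * t) * (of_int n - 1 / 6) ^ 2) :: complex)"
  have E: "(E t has_sum dedekind_eta (\<i> * of_real t)) UNIV" if "t > 0" for t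
    unfolding E_def by (rule dedekind_eta_imaginary[OF that])
  have "dedekind_eta (\<i> * of_real t) = (\<Sum>r\<in>{0..<2}. \<Sum>\<^sub>\<infinity>n. E t (2 * n + r))"
    using infsum_int_mod[of "E t" 2] E[OF t] by (auto simp: has_sum_iff)
  also have "{0..<2::int} = {0, 1}" by auto
  also have "(\<Sum>r\<in>{0,1}. \<Sum>\<^sub>\<infinity>n. E t (2 * n + r)) = (\<Sum>\<^sub>\<infinity>n. E t (2 * n)) + (\<Sum>\<^sub>\<infinity>n. E t (2 * n + 1))" by simp
  also have "(\<lambda>n. E t (2 * n)) = (\<lambda>n. exp (- of_real (pi * s) * (of_real (-1/12) + of_int n) ^ 2))"
  proof
    fix n :: int
    have "of_int (2 * n) - 1 / 6 = 2 * (of_real (-1/12) + of_int n :: complex)" by simp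
    hence "- of_real (3 * pi * t) * (of_int (2 * n) - 1 / 6) ^ 2 = - of_real (pi * s) * (of_real (-1/12) + of_int n :: complex) ^ 2"
      by (simp only: power_mult_distrib) (simp add: s_def)
    thus "E t (2 * n) = exp (- of_real (pi * s) * (of_real (-1/12) + of_int n) ^ 2)"
      unfolding E_def by (simp only: minus_one_powi_even mult_1)
  qed
  also have "(\<lambda>n. E t (2 * n + 1)) = (\<lambda>n. - exp (- of_real (pi * s) * (of_real (5/12) + of_int n) ^ 2))"
  proof
    fix n :: int
    have "of_int (2 * n + 1) - 1 / 6 = 2 * (of_real (5/12) + of_int n :: complex)" by simp
    hence *: "- of_real (3 * pi * t) * (of_int (2 * n + 1) - 1 / 6) ^ 2 = - of_real (pi * s) * (of_real (5/12) + of_int n :: complex) ^ 2"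
      by (simp only: power_mult_distrib) (simp add: s_def)
    have "(-1::complex) powi (2 * n + 1) = -1" by (simp add: power_int_add)
    thus "E t (2 * n + 1) = - exp (- of_real (pi * s) * (of_real (5/12) + of_int n) ^ 2)"
      unfolding E_def * by simp
  qed
  finally have eta_A: "dedekind_eta (\<i> * of_real t) = A (-1/12) - A (5/12)"
    by (simp add: A_def infsum_uminus)
  define T where "T = (\<lambda>k::int. complex_of_real (exp (- pi * of_int k ^ 2 / s)) * (cexp (of_int k * of_real (-1/12)) - cexp (of_int k * of_real (5/12))))"
  have "(T has_sum (of_real (sqrt s) * A (-1/12) - of_real (sqrt s) * A (5/12))) UNIV"
    using has_sum_add[OF poisson_gauss[OF s, of "-1/12"] has_sum_cmult_right[OF poisson_gauss[OF s, of "5/12"], of "-1"]]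
    unfolding T_def A_def by (simp only: right_diff_distrib mult_minus_left mult_1 add_uminus_conv_diff)
  hence T: "(T has_sum of_real (sqrt s) * dedekind_eta (\<i> * of_real t)) UNIV"
    by (simp add: eta_A algebra_simps)
  \<comment> \<open>The two shifts differ by \<open>1 / 2\<close>, hence the factor that kills every
    even \<open>k\<close>.\<close>
  have b: "cexp (of_int k * of_real (-1/12)) - cexp (of_int k * of_real (5/12)) = cexp (- of_int k / 12) * (1 - (-1) powi k)" for k
  proof -
    have "cexp (of_int k * of_real (5/12)) = cexp (- of_int k / 12) * cexp (of_int k / 2)"
      unfolding cexp_add[symmetric] by (simp add: field_simps)
    thus ?thesis by (simp add: cexp_half_int algebra_simps)
  qed
  have T_even: "T (6 * n + r) = 0" if "even r" for n r
    using that unfolding T_def b by (auto elim!: evenE simp: power_int_add)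
  have powi6: "(-1::complex) powi (6 * n) = 1" for n
    using minus_one_powi_even[of "3 * n"] by (simp del: minus_one_powi_even)
  have cexp6: "cexp (- of_int (6 * n + r) / 12) = (-1) powi n * cexp (- of_int r / 12)" for n r
  proof -
    have "cexp (- of_int (6 * n + r) / 12) = cexp (of_int (- n) / 2) * cexp (- of_int r / 12)"
      unfolding cexp_add[symmetric] by (rule arg_cong[of _ _ cexp]) (simp add: add_divide_distrib diff_divide_distrib)
    also have "cexp (of_int (- n) / 2) = (-1) powi n"
      unfolding cexp_half_int power_int_minus power_int_inverse[symmetric] by simp
    finally show ?thesis .
  qed
  have T_odd: "T (6 * n + r) = 2 * of_real (exp (- pi * of_int (6 * n + r) ^ 2 / s)) * (-1) powi n * cexp (- of_int r / 12)" if "odd r" for n r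
    using that unfolding T_def b cexp6 by (auto elim!: oddE simp: power_int_add powi6)
  have Einv: "E (1 / t) n = (-1) powi n * of_real (exp (- pi * of_int (6 * n - 1) ^ 2 / s))" for n
  proof -
    have "of_int n - 1 / 6 = (of_int (6 * n - 1) / 6 :: complex)" by (simp add: diff_divide_distrib)
    hence "- of_real (3 * pi * (1 / t)) * (of_int n - 1 / 6 :: complex) ^ 2 = of_real (- pi * of_int (6 * n - 1) ^ 2 / s)"
      unfolding s_def by (simp only: power_divide) simp
    thus ?thesis unfolding E_def by (simp only: exp_of_real)
  qed
  define \<eta> where "\<eta> = dedekind_eta (\<i> / of_real t)"
  have \<eta>: "(E (1 / t) has_sum \<eta>) UNIV" using E[of "1 / t"] t by (simp add: \<eta>_def)
  have 1: "(\<Sum>\<^sub>\<infinity>n. T (6 * n + 1)) = 2 * cexp (- 1 / 12) * \<eta>"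
  proof -
    have "(\<lambda>n. T (6 * n + 1)) = (\<lambda>n. 2 * cexp (- 1 / 12) * E (1 / t) (- n))"
    proof
      fix n :: int
      have "(6 * n + 1)^2 = (6 * (-n) - 1)^2" by (simp add: power2_eq_square algebra_simps)
      hence "(real_of_int (6 * n + 1))^2 = (real_of_int (6 * (-n) - 1))^2" by (metis of_int_power)
      moreover have "(-1::complex) powi (- n) = (-1) powi n"
        unfolding power_int_minus power_int_inverse[symmetric] by simp
      ultimately show "T (6 * n + 1) = 2 * cexp (- 1 / 12) * E (1 / t) (- n)"
        by (simp only: T_odd Einv odd_one not_False_eq_True of_int_1) (simp add: mult_ac)
    qed
    moreover have "(\<Sum>\<^sub>\<infinity>n. E (1 / t) (- n)) = \<eta>"
      using infsum_reindex_bij_betw[of uminus UNIV UNIV "E (1 / t)"] \<eta> bij_uminus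
      by (auto simp: has_sum_iff)
    ultimately show ?thesis by (simp add: infsum_cmult_right')
  qed
  have 5: "(\<Sum>\<^sub>\<infinity>n. T (6 * n + 5)) = 2 * cexp (1 / 12) * \<eta>"
  proof -
    have "(\<lambda>n. T (6 * n + 5)) = (\<lambda>n. 2 * cexp (1 / 12) * E (1 / t) (n + 1))"
    proof
      fix n :: int
      \<comment> \<open>Residue \<open>5\<close> is read as \<open>-1\<close>, which matches the
        exponent of \<open>E (1 / t)\<close> at \<open>n + 1\<close>.\<close>
      have "6 * n + 5 = 6 * (n + 1) + (-1)" by simp
      hence "T (6 * n + 5) = T (6 * (n + 1) + (-1))" by (rule arg_cong)
      also have "\<dots> = 2 * cexp (1 / 12) * E (1 / t) (n + 1)"
        unfolding Einv by (subst T_odd) (simp_all add: mult_ac)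
      finally show "T (6 * n + 5) = 2 * cexp (1 / 12) * E (1 / t) (n + 1)" .
    qed
    moreover have "bij (\<lambda>n::int. n + 1)" by (rule bij_betw_byWitness[where f' = "\<lambda>n. n - 1"]) auto
    hence "(\<Sum>\<^sub>\<infinity>n. E (1 / t) (n + 1)) = \<eta>"
      using infsum_reindex_bij_betw[of "\<lambda>n. n + 1" UNIV UNIV "E (1 / t)"] \<eta>
      by (auto simp: has_sum_iff)
    ultimately show ?thesis by (simp add: infsum_cmult_right')
  qed
  have 3: "(\<Sum>\<^sub>\<infinity>n. T (6 * n + 3)) = 0"
  proof -
    \<comment> \<open>The reflection sends \<open>6 * n + 3\<close> to its negative and changes the
      parity of \<open>n\<close>, so the sum equals its own negative.\<close>
    have "T (6 * (- 1 - n) + 3) = - T (6 * n + 3)" for n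
    proof -
      have "(6 * (- 1 - n) + 3)^2 = (6 * n + 3)^2" by (simp add: power2_eq_square algebra_simps)
      hence "(real_of_int (6 * (- 1 - n) + 3))^2 = (real_of_int (6 * n + 3))^2" by (metis of_int_power)
      moreover have "(-1::complex) powi (- 1 - n) = - ((-1) powi n)"
      proof -
        have "(-1::complex) powi (- 1 - n) = inverse ((-1) powi (1 + n))"
          unfolding power_int_minus[symmetric] by simp
        thus ?thesis unfolding power_int_inverse[symmetric] by (simp add: power_int_add)
      qed
      ultimately show ?thesis by (simp only: T_odd odd_numeral not_False_eq_True) simp
    qed
    moreover have "bij (\<lambda>n::int. -1 - n)" by (rule bij_betw_byWitness[where f' = "\<lambda>n. -1 - n"]) auto
    hence "(\<Sum>\<^sub>\<infinity>n. T (6 * (-1 - n) + 3)) = (\<Sum>\<^sub>\<infinity>n. T (6 * n + 3))"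
      by (rule infsum_reindex_bij_betw)
    ultimately show ?thesis by (simp add: infsum_uminus)
  qed
  have "of_real (sqrt s) * dedekind_eta (\<i> * of_real t) = (\<Sum>r\<in>{0..<6}. \<Sum>\<^sub>\<infinity>n. T (6 * n + r))"
    using infsum_int_mod[of T 6] T by (auto simp: has_sum_iff)
  also have "{0..<6::int} = {0, 1, 2, 3, 4, 5}" by auto
  also have "(\<Sum>r\<in>\<dots>. \<Sum>\<^sub>\<infinity>n. T (6 * n + r)) = 2 * (cexp (1 / 12) + cexp (- 1 / 12)) * \<eta>"
    using T_even[of 0] T_even[of 2] T_even[of 4] 1 3 5 by (simp add: algebra_simps)
  also have "\<dots> = of_real (2 * sqrt 3) * \<eta>" by (simp only: cexp_twelfth) simp
  also have "sqrt s = 2 * sqrt 3 * sqrt t"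
  proof -
    have "s = 2\<^sup>2 * (3 * t)" by (simp add: s_def)
    thus ?thesis by (simp only: real_sqrt_mult real_sqrt_abs abs_numeral mult.assoc)
  qed
  finally show ?thesis by (simp add: \<eta>_def)
qed

text \<open>On the upper half-plane \<open>- \<i> * \<tau>\<close> stays in the right half-plane,
  away from the cut of \<open>csqrt\<close>, so both sides are holomorphic and the identity theorem
  extends the equality from the imaginary axis.\<close>

lemma dedekind_eta_inversion:
  assumes \<tau>: "Im \<tau> > 0"
  shows "dedekind_eta (- 1 / \<tau>) = csqrt (- \<i> * \<tau>) * dedekind_eta \<tau>"
proof -
  define S where "S = {z. 0 < Im z}"
  define g where "g = (\<lambda>z. dedekind_eta (- 1 / z) - csqrt (- \<i> * z) * dedekind_eta z)"
  have holo: "g holomorphic_on S" unfolding g_def S_def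
    by (intro holomorphic_intros)
       (auto simp: Im_divide complex_nonpos_Reals_iff intro!: divide_pos_pos sum_power2_gt_zero_iff[THEN iffD2])
  have zero: "g (\<i> * of_real t) = 0" if "t > 0" for t
  proof -
    have "- 1 / (\<i> * complex_of_real t) = \<i> / of_real t" using that by (simp add: field_simps)
    thus ?thesis using dedekind_eta_inversion_imaginary[OF that] that
      by (simp add: g_def csqrt_of_real_nonneg)
  qed
  have lim: "\<i> islimpt (\<lambda>t. \<i> * of_real t) ` {0<..}"
    unfolding islimpt_approachable
  proof safe
    fix e :: real assume e: "e > 0"
    have "dist (\<i> * of_real (1 + e / 2)) \<i> = e / 2"
      using e by (simp add: dist_norm algebra_simps norm_mult)
    thus "\<exists>x'\<in>(\<lambda>t. \<i> * of_real t) ` {0<..}. x' \<noteq> \<i> \<and> dist x' \<i> < e"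
      using e by (intro bexI[of _ "\<i> * of_real (1 + e / 2)"] conjI imageI) auto
  qed
  have S: "connected S" "open S" unfolding S_def
    by (auto intro: convex_connected convex_halfspace_Im_gt open_halfspace_Im_gt)
  have "g \<tau> = 0"
  proof (rule analytic_continuation[OF holo S(2,1) _ _ lim])
    show "(\<lambda>t. \<i> * of_real t) ` {0<..} \<subseteq> S" by (auto simp: S_def)
    show "\<i> \<in> S" "\<tau> \<in> S" using \<tau> by (auto simp: S_def)
    fix z assume "z \<in> (\<lambda>t. \<i> * of_real t) ` {0<..}"
    thus "g z = 0" using zero by blast
  qed
  thus ?thesis by (simp add: g_def)
qed

section \<open>Transformations of level 21\<close>

text \<open>The two arguments add up to less than \<open>pi\<close> in absolute value, so no branch
  jump occurs. The closed bounds on \<open>Arg w\<close> admit \<open>w = \<i>\<close> and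
  \<open>w = - \<i>\<close>.\<close>

lemma csqrt_mult_right_half_plane:
  assumes "Re z > 0" "-pi / 2 \<le> Arg w" "Arg w \<le> pi / 2"
  shows "csqrt (w * z) = csqrt w * csqrt z"
proof -
  have "\<bar>Arg z\<bar> < pi / 2" using assms Arg_Re_pos by blast
  thus ?thesis using assms by (intro csqrt_mult) auto
qed

text \<open>These eighth roots of unity are the source of the corrections \<open>-3\<close> and
  \<open>+3\<close> to the multiplier exponent.\<close>

lemma csqrt_pm_i:
  shows "csqrt (- \<i>) = cexp (- 3 / 24)" "csqrt \<i> = cexp (3 / 24)"
proof -
  have "cexp (- 3 / 24) = cis (- (pi / 4))" "cexp (3 / 24) = cis (pi / 4)"
    by (simp_all add: cexp_def cis_conv_exp mult_ac)
  moreover have "csqrt (- \<i>) = cis (- (pi / 4))" "csqrt \<i> = cis (pi / 4)"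
    by (rule csqrt_unique; simp add: Complex.DeMoivre complex_eq_iff cos_45)+
  ultimately show "csqrt (- \<i>) = cexp (- 3 / 24)" "csqrt \<i> = cexp (3 / 24)"
    by (simp_all only:)
qed

section \<open>Moebius transformations and the eta multiplier\<close>

lemma moebius_pole:
  fixes \<tau> :: complex and a b c d :: int
  assumes "Im \<tau> > 0" "c \<noteq> 0 \<or> d \<noteq> 0"
  shows "of_int c * \<tau> + of_int d \<noteq> 0"
proof
  assume *: "of_int c * \<tau> + of_int d = 0"
  hence "Im (of_int c * \<tau> + of_int d) = 0" by simp
  hence "c = 0" using assms(1) by simp
  with * assms(2) show False by simp
qed

lemma Im_moebius:
  fixes \<tau> :: complex and a b c d :: int
  assumes "of_int c * \<tau> + of_int d \<noteq> 0"
  shows "Im ((of_int a * \<tau> + of_int b) / (of_int c * \<tau> + of_int d)) =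
     of_int (a * d - b * c) * Im \<tau> / norm (of_int c * \<tau> + of_int d) ^ 2"
  using assms by (simp add: Im_divide cmod_power2 algebra_simps)

text \<open>
  The lower row is normalised by \<open>c > 0\<close>, so that \<open>csqrt\<close> is only evaluated in the right half-plane;
  the multiplier is the \<open>k\<close>-th power of \<open>exp (2 \<pi> \<i> / 24)\<close>.
\<close>

definition eta_trans :: "int \<Rightarrow> int \<Rightarrow> int \<Rightarrow> int \<Rightarrow> int \<Rightarrow> bool" where
  "eta_trans a b c d k \<longleftrightarrow> c > 0 \<and> a * d - b * c = 1 \<and>
     (\<forall>\<tau>. Im \<tau> > 0 \<longrightarrow> dedekind_eta ((of_int a * \<tau> + of_int b) / (of_int c * \<tau> + of_int d)) =
        cexp (of_int k / 24) * csqrt (- \<i> * (of_int c * \<tau> + of_int d)) * dedekind_eta \<tau>)"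

lemma eta_transD:
  assumes "eta_trans a b c d k" "Im \<tau> > 0"
  shows "dedekind_eta ((of_int a * \<tau> + of_int b) / (of_int c * \<tau> + of_int d)) =
        cexp (of_int k / 24) * csqrt (- \<i> * (of_int c * \<tau> + of_int d)) * dedekind_eta \<tau>"
  using assms by (simp add: eta_trans_def)

text \<open>Inversion applied at \<open>\<tau> + m\<close>; every chain in
  \<open>eta_trans_table\<close> starts here.\<close>

lemma eta_trans_ST: "eta_trans 0 (-1) 1 m m"
  unfolding eta_trans_def
proof (intro conjI allI impI)
  fix \<tau> :: complex assume "Im \<tau> > 0"
  hence "Im (\<tau> + of_int m) > 0" by simp
  from dedekind_eta_inversion[OF this]
  show "dedekind_eta ((of_int 0 * \<tau> + of_int (-1)) / (of_int 1 * \<tau> + of_int m)) =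
        cexp (of_int m / 24) * csqrt (- \<i> * (of_int 1 * \<tau> + of_int m)) * dedekind_eta \<tau>"
    by (simp add: dedekind_eta_translate mult_ac)
qed auto

text \<open>Left multiplication by \<open>T^m\<close> keeps the lower row, and with it the square
  root, unchanged.\<close>

lemma eta_trans_T:
  assumes "eta_trans a b c d k"
  shows "eta_trans (a + m * c) (b + m * d) c d (k + m)"
  unfolding eta_trans_def
proof (intro conjI allI impI)
  fix \<tau> :: complex assume \<tau>: "Im \<tau> > 0"
  have "c > 0" using assms by (simp add: eta_trans_def)
  hence nz: "of_int c * \<tau> + of_int d \<noteq> 0" using \<tau> by (intro moebius_pole) auto
  hence eq: "(of_int (a + m * c) * \<tau> + of_int (b + m * d)) / (of_int c * \<tau> + of_int d) =
     (of_int a * \<tau> + of_int b) / (of_int c * \<tau> + of_int d) + of_int m"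
    by (simp add: field_simps)
  show "dedekind_eta ((of_int (a + m * c) * \<tau> + of_int (b + m * d)) / (of_int c * \<tau> + of_int d)) =
        cexp (of_int (k + m) / 24) * csqrt (- \<i> * (of_int c * \<tau> + of_int d)) * dedekind_eta \<tau>"
    unfolding eq dedekind_eta_translate eta_transD[OF assms \<tau>]
    by (simp add: add_divide_distrib cexp_add)
qed (use assms in \<open>auto simp: eta_trans_def algebra_simps\<close>)

text \<open>Left multiplication by \<open>S\<close> before the new lower row \<open>(a, b)\<close>
  is normalised. Both square roots have arguments in the right half-plane, so they merge into one;
  the sign of \<open>a\<close> decides how it is split again.\<close>

lemma dedekind_eta_inversion_moebius:
  assumes "eta_trans a b c d k" "Im \<tau> > 0"
  shows "dedekind_eta ((- of_int c * \<tau> - of_int d) / (of_int a * \<tau> + of_int b)) =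
    cexp (of_int k / 24) * csqrt (- (of_int a * \<tau> + of_int b)) * dedekind_eta \<tau>"
proof -
  define w where "w = of_int c * \<tau> + of_int d"
  define z where "z = (of_int a * \<tau> + of_int b) / w"
  have c: "c > 0" "a * d - b * c = 1" using assms by (auto simp: eta_trans_def)
  hence nz: "w \<noteq> 0" unfolding w_def using assms by (intro moebius_pole) auto
  have Imz: "Im z > 0" unfolding z_def w_def
    using Im_moebius[OF nz[unfolded w_def], of a b] c assms(2) nz by (simp add: w_def)
  have Imw: "Im w > 0" using c assms(2) by (simp add: w_def)
  have arg: "- pi / 2 \<le> Arg (- \<i> * z)" "Arg (- \<i> * z) \<le> pi / 2"
    using Arg_Re_pos[of "- \<i> * z"] Imz by auto
  have "(- of_int c * \<tau> - of_int d) / (of_int a * \<tau> + of_int b) = - 1 / z"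
    by (simp add: z_def w_def minus_divide_left)
  also have "dedekind_eta \<dots> = csqrt (- \<i> * z) * dedekind_eta z"
    by (rule dedekind_eta_inversion[OF Imz])
  also have "dedekind_eta z = cexp (of_int k / 24) * csqrt (- \<i> * w) * dedekind_eta \<tau>"
    unfolding z_def w_def by (rule eta_transD[OF assms])
  also have "csqrt (- \<i> * z) * (cexp (of_int k / 24) * csqrt (- \<i> * w) * dedekind_eta \<tau>) =
     cexp (of_int k / 24) * (csqrt (- \<i> * z) * csqrt (- \<i> * w)) * dedekind_eta \<tau>" by simp
  also have "csqrt (- \<i> * z) * csqrt (- \<i> * w) = csqrt ((- \<i> * z) * (- \<i> * w))"
    using arg Imw by (intro csqrt_mult_right_half_plane[symmetric]) auto
  also have "(- \<i> * z) * (- \<i> * w) = - (of_int a * \<tau> + of_int b)"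
  proof -
    have "(- \<i> * z) * (- \<i> * w) = - (z * w)" by (simp add: complex_eq_iff algebra_simps)
    thus ?thesis using nz by (simp add: z_def)
  qed
  finally show ?thesis .
qed

text \<open>The row \<open>(a, b)\<close> is already normalised; splitting off
  \<open>csqrt (- \<i>)\<close> lowers the exponent by \<open>3\<close>.\<close>

lemma eta_trans_S_pos:
  assumes "eta_trans a b c d k" "a > 0"
  shows "eta_trans (- c) (- d) a b (k - 3)"
  unfolding eta_trans_def
proof (intro conjI allI impI)
  fix \<tau> :: complex assume \<tau>: "Im \<tau> > 0"
  have "csqrt (- \<i> * (- \<i> * (of_int a * \<tau> + of_int b))) = csqrt (- \<i>) * csqrt (- \<i> * (of_int a * \<tau> + of_int b))"
    using assms(2) \<tau> by (intro csqrt_mult_right_half_plane) (auto simp: Arg_minus_ii)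
  moreover have "- \<i> * (- \<i> * (of_int a * \<tau> + of_int b)) = - (of_int a * \<tau> + of_int b)" by simp
  ultimately have 1: "csqrt (- (of_int a * \<tau> + of_int b)) = cexp (- 3 / 24) * csqrt (- \<i> * (of_int a * \<tau> + of_int b))"
    by (simp only: csqrt_pm_i)
  have 2: "cexp (of_int (k - 3) / 24) = cexp (of_int k / 24) * cexp (- 3 / 24)"
    unfolding cexp_add[symmetric] by (simp add: diff_divide_distrib)
  have 3: "of_int (- c) * \<tau> + of_int (- d) = - of_int c * \<tau> - of_int d" by simp
  show "dedekind_eta ((of_int (- c) * \<tau> + of_int (- d)) / (of_int a * \<tau> + of_int b)) =
        cexp (of_int (k - 3) / 24) * csqrt (- \<i> * (of_int a * \<tau> + of_int b)) * dedekind_eta \<tau>"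
    unfolding 3 dedekind_eta_inversion_moebius[OF assms(1) \<tau>] 1 2 by (simp only: mult.assoc)
qed (use assms in \<open>auto simp: eta_trans_def algebra_simps\<close>)

text \<open>The matrix is negated to make its lower left entry positive, so
  \<open>csqrt \<i>\<close> is split off instead.\<close>

lemma eta_trans_S_neg:
  assumes "eta_trans a b c d k" "a < 0"
  shows "eta_trans c d (- a) (- b) (k + 3)"
  unfolding eta_trans_def
proof (intro conjI allI impI)
  fix \<tau> :: complex assume \<tau>: "Im \<tau> > 0"
  have "csqrt (\<i> * (- \<i> * (of_int (- a) * \<tau> + of_int (- b)))) = csqrt \<i> * csqrt (- \<i> * (of_int (- a) * \<tau> + of_int (- b)))"
    using assms(2) \<tau> by (intro csqrt_mult_right_half_plane) (auto simp: mult_neg_pos)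
  moreover have "\<i> * (- \<i> * (of_int (- a) * \<tau> + of_int (- b))) = - (of_int a * \<tau> + of_int b)" by simp
  ultimately have 1: "csqrt (- (of_int a * \<tau> + of_int b)) = cexp (3 / 24) * csqrt (- \<i> * (of_int (- a) * \<tau> + of_int (- b)))"
    by (simp only: csqrt_pm_i)
  have 2: "cexp (of_int (k + 3) / 24) = cexp (of_int k / 24) * cexp (3 / 24)"
    unfolding cexp_add[symmetric] by (simp add: add_divide_distrib)
  have 3: "(of_int c * \<tau> + of_int d) / (of_int (- a) * \<tau> + of_int (- b)) = (- of_int c * \<tau> - of_int d) / (of_int a * \<tau> + of_int b)"
    by (subst minus_divide_divide[symmetric]) (simp add: add_ac)
  show "dedekind_eta ((of_int c * \<tau> + of_int d) / (of_int (- a) * \<tau> + of_int (- b))) =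
        cexp (of_int (k + 3) / 24) * csqrt (- \<i> * (of_int (- a) * \<tau> + of_int (- b))) * dedekind_eta \<tau>"
    unfolding 3 dedekind_eta_inversion_moebius[OF assms(1) \<tau>] 1 2 by (simp only: mult.assoc)
qed (use assms in \<open>auto simp: eta_trans_def algebra_simps\<close>)

text \<open>Each matrix is built up from \<open>S T\<^sup>m\<close> along a continued fraction expansion of \<open>a / c\<close>.\<close>

lemma eta_trans_table:
  "eta_trans 1 2 3 7 2" "eta_trans 1 6 1 7 8" "eta_trans 7 2 3 1 2" "eta_trans 7 6 1 1 8"
  "eta_trans 3 (-4) 7 (-9) 0" "eta_trans 9 (-4) 7 (-3) 0" "eta_trans 3 (-28) 1 (-9) (-6)" "eta_trans 9 (-28) 1 (-3) 6"
  "eta_trans (-3) (-4) 7 9 0" "eta_trans (-9) (-4) 7 3 0" "eta_trans (-3) (-28) 1 9 6" "eta_trans (-9) (-28) 1 3 (-6)"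
proof -
  have T: "eta_trans a b c d k \<Longrightarrow> a' = a + m * c \<Longrightarrow> b' = b + m * d \<Longrightarrow> k' = k + m \<Longrightarrow> eta_trans a' b' c d k'"
    for a b c d k m a' b' k' using eta_trans_T by simp
  note P = eta_trans_S_pos[simplified] and N = eta_trans_S_neg[simplified]
  have "eta_trans (-3) (-7) 1 2 (-1)" by (rule T[OF eta_trans_ST[of 2], of _ "-3"]) auto
  from N[OF this] show "eta_trans 1 2 3 7 2" by simp
  show "eta_trans 1 6 1 7 8" by (rule T[OF eta_trans_ST[of 7], of _ 1]) auto
  have "eta_trans (-3) (-1) 1 0 (-3)" by (rule T[OF eta_trans_ST[of 0], of _ "-3"]) auto
  from N[OF this] have "eta_trans 1 0 3 1 0" by simp
  from T[OF this, of _ 2] show "eta_trans 7 2 3 1 2" by simp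
  show "eta_trans 7 6 1 1 8" by (rule T[OF eta_trans_ST[of 1], of _ 7]) auto
  have "eta_trans 3 (-4) 1 (-1) 2" by (rule T[OF eta_trans_ST[of "-1"], of _ 3]) auto
  from P[OF this] have "eta_trans (-1) 1 3 (-4) (-1)" by simp
  from T[OF this, of _ "-2"] have "eta_trans (-7) 9 3 (-4) (-3)" by simp
  from N[OF this] show "eta_trans 3 (-4) 7 (-9) 0" by simp
  have "eta_trans (-2) 1 1 (-1) (-3)" by (rule T[OF eta_trans_ST[of "-1"], of _ "-2"]) auto
  from N[OF this] have "eta_trans 1 (-1) 2 (-1) 0" by simp
  from T[OF this, of _ "-4"] have "eta_trans (-7) 3 2 (-1) (-4)" by simp
  from N[OF this] have "eta_trans 2 (-1) 7 (-3) (-1)" by simp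
  from T[OF this, of _ 1] show "eta_trans 9 (-4) 7 (-3) 0" by simp
  show "eta_trans 3 (-28) 1 (-9) (-6)" by (rule T[OF eta_trans_ST[of "-9"], of _ 3]) auto
  show "eta_trans 9 (-28) 1 (-3) 6" by (rule T[OF eta_trans_ST[of "-3"], of _ 9]) auto
  have "eta_trans (-3) (-4) 1 1 (-2)" by (rule T[OF eta_trans_ST[of 1], of _ "-3"]) auto
  from N[OF this] have "eta_trans 1 1 3 4 1" by simp
  from T[OF this, of _ 2] have "eta_trans 7 9 3 4 3" by simp
  from P[OF this] show "eta_trans (-3) (-4) 7 9 0" by simp
  have "eta_trans 2 1 1 1 3" by (rule T[OF eta_trans_ST[of 1], of _ 2]) auto
  from P[OF this] have "eta_trans (-1) (-1) 2 1 0" by simp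
  from T[OF this, of _ 4] have "eta_trans 7 3 2 1 4" by simp
  from P[OF this] have "eta_trans (-2) (-1) 7 3 1" by simp
  from T[OF this, of _ "-1"] show "eta_trans (-9) (-4) 7 3 0" by simp
  show "eta_trans (-3) (-28) 1 9 6" by (rule T[OF eta_trans_ST[of 9], of _ "-3"]) auto
  show "eta_trans (-9) (-28) 1 3 (-6)" by (rule T[OF eta_trans_ST[of 3], of _ "-9"]) auto
qed

text \<open>With \<open>a\<close> and \<open>b\<close> as at the top, \<open>X21\<close> is \<open>ab = u\<^sub>1\<close> and \<open>V21\<close> is \<open>(b/a)\<^sup>2\<close>.\<close>

definition X21 :: "complex \<Rightarrow> complex" where
  "X21 \<tau> = dedekind_eta \<tau> * dedekind_eta (3 * \<tau>) / (dedekind_eta (7 * \<tau>) * dedekind_eta (21 * \<tau>))"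

definition V21 :: "complex \<Rightarrow> complex" where
  "V21 \<tau> = (dedekind_eta (3 * \<tau>) * dedekind_eta (7 * \<tau>) / (dedekind_eta \<tau> * dedekind_eta (21 * \<tau>))) ^ 2"

section \<open>Eta quotients under the Fricke and Atkin-Lehner involutions\<close>

lemma csqrt_of_real_mult: "r > 0 \<Longrightarrow> csqrt (of_real r * z) = of_real (sqrt r) * csqrt z"
  using csqrt_mult[of "of_real r" z] mpi_less_Arg[of z] Arg_le_pi[of z] by (simp add: csqrt_of_real_nonneg)

lemma csqrt_nonzero: "Im z > 0 \<Longrightarrow> csqrt (- \<i> * z) \<noteq> 0"
  by (auto simp: csqrt_eq_0)

text \<open>The involution swaps the eta factors at levels 1 and 21 and those at 3 and 7. The square
  root factors cancel in \<open>V21\<close> and leave \<open>7\<close> in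
  \<open>X21\<close>.\<close>

lemma level21_fricke:
  assumes \<tau>: "Im \<tau> > 0"
  shows "X21 (- 1 / (21 * \<tau>)) = 7 / X21 \<tau>" "V21 (- 1 / (21 * \<tau>)) = V21 \<tau>"
proof -
  define r where "r = csqrt (- \<i> * \<tau>)"
  have sq: "csqrt (- \<i> * (of_real m * \<tau>)) = of_real (sqrt m) * r" if "m > 0" for m
    using csqrt_of_real_mult[OF that, of "- \<i> * \<tau>"] by (simp add: r_def mult_ac)
  have e: "dedekind_eta (- 1 / (of_real m * \<tau>)) = of_real (sqrt m) * r * dedekind_eta (of_real m * \<tau>)" if "m > 0" for m
    using dedekind_eta_inversion[of "of_real m * \<tau>"] that \<tau> by (simp only: sq) simp
  have [simp]: "r \<noteq> 0" unfolding r_def using \<tau> by (rule csqrt_nonzero)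
  have nz: "dedekind_eta \<tau> \<noteq> 0" "dedekind_eta (3 * \<tau>) \<noteq> 0" "dedekind_eta (7 * \<tau>) \<noteq> 0" "dedekind_eta (21 * \<tau>) \<noteq> 0"
    using \<tau> by (auto intro!: dedekind_eta_nonzero)
  have e1: "dedekind_eta (- 1 / (21 * \<tau>)) = of_real (sqrt 21) * r * dedekind_eta (21 * \<tau>)"
    using e[of 21] by simp
  have e3: "dedekind_eta (3 * (- 1 / (21 * \<tau>))) = of_real (sqrt 7) * r * dedekind_eta (7 * \<tau>)"
    using e[of 7] by simp
  have e7: "dedekind_eta (7 * (- 1 / (21 * \<tau>))) = of_real (sqrt 3) * r * dedekind_eta (3 * \<tau>)"
    using e[of 3] by simp
  have e21: "dedekind_eta (21 * (- 1 / (21 * \<tau>))) = r * dedekind_eta \<tau>"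
    using e[of 1] by simp
  have s: "complex_of_real (sqrt 21) * of_real (sqrt 7) = 7 * of_real (sqrt 3)"
     "complex_of_real (sqrt 7) * of_real (sqrt 3) = of_real (sqrt 21)"
  proof -
    have "sqrt 7 * sqrt 3 = sqrt 21" by (simp flip: real_sqrt_mult)
    moreover from this have "sqrt 21 * sqrt 7 = 7 * sqrt 3" by (simp flip: \<open>_ = sqrt 21\<close>)
    ultimately show "complex_of_real (sqrt 21) * of_real (sqrt 7) = 7 * of_real (sqrt 3)"
     "complex_of_real (sqrt 7) * of_real (sqrt 3) = of_real (sqrt 21)"
      by (metis of_real_mult of_real_numeral)+
  qed
  have "X21 (- 1 / (21 * \<tau>)) = (of_real (sqrt 21) * of_real (sqrt 7)) / of_real (sqrt 3) *
     (dedekind_eta (21 * \<tau>) * dedekind_eta (7 * \<tau>) / (dedekind_eta (3 * \<tau>) * dedekind_eta \<tau>))"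
    unfolding X21_def e1 e3 e7 e21 by (simp add: field_simps)
  also have "\<dots> = 7 / X21 \<tau>" unfolding s using nz by (simp add: X21_def mult_ac)
  finally show "X21 (- 1 / (21 * \<tau>)) = 7 / X21 \<tau>" .
  have "V21 (- 1 / (21 * \<tau>)) = ((of_real (sqrt 7) * of_real (sqrt 3)) / of_real (sqrt 21) *
     (dedekind_eta (7 * \<tau>) * dedekind_eta (3 * \<tau>) / (dedekind_eta (21 * \<tau>) * dedekind_eta \<tau>))) ^ 2"
    unfolding V21_def e1 e3 e7 e21 by (simp add: field_simps)
  also have "\<dots> = V21 \<tau>" unfolding s by (simp add: V21_def mult_ac)
  finally show "V21 (- 1 / (21 * \<tau>)) = V21 \<tau>" .
qed

text \<open>Atkin-Lehner involution of determinant 7, swapping levels 1 with 7 and 3 with 21. The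
  roots of unity \<open>m\<close> and \<open>l\<close> each occur once above and once below the
  fraction bar, and \<open>sqrt 7\<close> survives twice in \<open>X21\<close>.\<close>

lemma level21_W7:
  assumes \<tau>: "Im \<tau> > 0"
  shows "X21 ((7 * \<tau> + 2) / (21 * \<tau> + 7)) = 7 / X21 \<tau>" "V21 ((7 * \<tau> + 2) / (21 * \<tau> + 7)) = 1 / V21 \<tau>"
proof -
  define \<sigma> where "\<sigma> = (7 * \<tau> + 2) / (21 * \<tau> + 7)"
  define r where "r = csqrt (- \<i> * (3 * \<tau> + 1))"
  define m where "m = cexp (2 / 24)"
  define l where "l = cexp (8 / 24)"
  have [simp]: "r \<noteq> 0" unfolding r_def using \<tau> by (intro csqrt_nonzero) auto
  have [simp]: "m \<noteq> 0" "l \<noteq> 0" by (auto simp: m_def l_def)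
  have p1: "3 * \<tau> + 1 \<noteq> 0" using moebius_pole[OF \<tau>, of 3 1] by simp
  have p7: "21 * \<tau> + 7 \<noteq> 0" using moebius_pole[OF \<tau>, of 21 7] by simp
  have r7: "csqrt (- \<i> * (21 * \<tau> + 7)) = of_real (sqrt 7) * r"
    using csqrt_of_real_mult[of 7 "- \<i> * (3 * \<tau> + 1)"] by (simp add: r_def algebra_simps)
  have nz: "dedekind_eta \<tau> \<noteq> 0" "dedekind_eta (3 * \<tau>) \<noteq> 0" "dedekind_eta (7 * \<tau>) \<noteq> 0" "dedekind_eta (21 * \<tau>) \<noteq> 0"
    using \<tau> by (auto intro!: dedekind_eta_nonzero)
  have e1: "dedekind_eta \<sigma> = m * (of_real (sqrt 7) * r) * dedekind_eta (7 * \<tau>)"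
    using eta_transD[OF eta_trans_table(1), of "7 * \<tau>"] \<tau> r7 by (simp add: \<sigma>_def m_def)
  have e3: "dedekind_eta (3 * \<sigma>) = l * (of_real (sqrt 7) * r) * dedekind_eta (21 * \<tau>)"
    using eta_transD[OF eta_trans_table(2), of "21 * \<tau>"] \<tau> r7 by (simp add: \<sigma>_def l_def)
  have "7 * \<sigma> = (7 * \<tau> + 2) / (3 * \<tau> + 1)" using p1 p7 by (simp add: \<sigma>_def field_simps)
  hence e7: "dedekind_eta (7 * \<sigma>) = m * r * dedekind_eta \<tau>"
    using eta_transD[OF eta_trans_table(3), of \<tau>] \<tau> by (simp add: m_def r_def)
  have "21 * \<sigma> = (21 * \<tau> + 6) / (3 * \<tau> + 1)" using p1 p7 by (simp add: \<sigma>_def field_simps)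
  hence e21: "dedekind_eta (21 * \<sigma>) = l * r * dedekind_eta (3 * \<tau>)"
    using eta_transD[OF eta_trans_table(4), of "3 * \<tau>"] \<tau> by (simp add: l_def r_def)
  have "X21 \<sigma> = of_real (sqrt 7) * of_real (sqrt 7) * (dedekind_eta (7 * \<tau>) * dedekind_eta (21 * \<tau>) / (dedekind_eta \<tau> * dedekind_eta (3 * \<tau>)))"
    unfolding X21_def e1 e3 e7 e21 by (simp add: field_simps)
  also have "complex_of_real (sqrt 7) * of_real (sqrt 7) = 7" by (simp flip: of_real_mult)
  finally show "X21 ((7 * \<tau> + 2) / (21 * \<tau> + 7)) = 7 / X21 \<tau>" by (simp add: X21_def \<sigma>_def mult_ac)
  have "V21 \<sigma> = (dedekind_eta (21 * \<tau>) * dedekind_eta \<tau> / (dedekind_eta (7 * \<tau>) * dedekind_eta (3 * \<tau>))) ^ 2"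
    unfolding V21_def e1 e3 e7 e21 by (simp add: field_simps)
  thus "V21 ((7 * \<tau> + 2) / (21 * \<tau> + 7)) = 1 / V21 \<tau>" by (simp add: V21_def \<sigma>_def power_divide mult_ac)
qed

text \<open>Common computation for two matrices of determinant 3, which swap levels 1 with 3 and 7
  with 21. They differ only in the roots of unity \<open>m\<close> and \<open>m'\<close>.\<close>

lemma level21_W3_aux:
  assumes e1: "dedekind_eta \<sigma> = of_real (sqrt 3) * r * dedekind_eta (3 * \<tau>)"
    and e3: "dedekind_eta (3 * \<sigma>) = r * dedekind_eta \<tau>"
    and e7: "dedekind_eta (7 * \<sigma>) = m * (of_real (sqrt 3) * r) * dedekind_eta (21 * \<tau>)"
    and e21: "dedekind_eta (21 * \<sigma>) = m' * r * dedekind_eta (7 * \<tau>)"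
    and m: "m * m' = 1" "m ^ 2 = m' ^ 2" and "r \<noteq> 0"
  shows "X21 \<sigma> = X21 \<tau>" "V21 \<sigma> = 1 / V21 \<tau>"
proof -
  have [simp]: "m \<noteq> 0" "m' \<noteq> 0" using m by auto
  have "X21 \<sigma> = 1 / (m * m') * (dedekind_eta (3 * \<tau>) * dedekind_eta \<tau> / (dedekind_eta (21 * \<tau>) * dedekind_eta (7 * \<tau>)))"
    unfolding X21_def e1 e3 e7 e21 using \<open>r \<noteq> 0\<close> by (simp add: field_simps)
  thus "X21 \<sigma> = X21 \<tau>" by (simp add: m X21_def mult_ac)
  have "V21 \<sigma> = m ^ 2 / m' ^ 2 * (dedekind_eta \<tau> * dedekind_eta (21 * \<tau>) / (dedekind_eta (3 * \<tau>) * dedekind_eta (7 * \<tau>))) ^ 2"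
    unfolding V21_def e1 e3 e7 e21 power_divide[symmetric] power_mult_distrib[symmetric]
    using \<open>r \<noteq> 0\<close> by (simp add: field_simps)
  thus "V21 \<sigma> = 1 / V21 \<tau>" by (simp add: m V21_def power_divide)
qed

text \<open>\<open>cexp (6 / 24)\<close> and \<open>cexp (- 6 / 24)\<close> are \<open>\<i>\<close>
  and \<open>- \<i>\<close>: mutually inverse, with the same square.\<close>

lemma cexp_quarter:
  "cexp (6 / 24) * cexp (- 6 / 24) = 1" "cexp (- 6 / 24) * cexp (6 / 24) = 1"
  "cexp (6 / 24) ^ 2 = cexp (- 6 / 24) ^ 2" "cexp (- 6 / 24) ^ 2 = cexp (6 / 24) ^ 2"
  using cexp_minus[of "1 / 2"] unfolding cexp_power unfolding cexp_add[symmetric] by auto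

lemma level21_W3:
  assumes \<tau>: "Im \<tau> > 0"
  shows "X21 ((9 * \<tau> - 4) / (21 * \<tau> - 9)) = X21 \<tau>" "V21 ((9 * \<tau> - 4) / (21 * \<tau> - 9)) = 1 / V21 \<tau>"
proof -
  have \<tau>': "Im (3 * \<tau>) > 0" "Im (7 * \<tau>) > 0" "Im (21 * \<tau>) > 0" using \<tau> by auto
  define \<sigma> where "\<sigma> = (9 * \<tau> - 4) / (21 * \<tau> - 9)"
  define r where "r = csqrt (- \<i> * (7 * \<tau> - 3))"
  have r0: "r \<noteq> 0" unfolding r_def using \<tau> by (intro csqrt_nonzero) auto
  have p: "7 * \<tau> - 3 \<noteq> 0" "21 * \<tau> - 9 \<noteq> 0" using moebius_pole[OF \<tau>, of 7 "-3"] moebius_pole[OF \<tau>, of 21 "-9"] by simp_all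
  have r3: "csqrt (- \<i> * (21 * \<tau> - 9)) = of_real (sqrt 3) * r"
    using csqrt_of_real_mult[of 3 "- \<i> * (7 * \<tau> - 3)"] by (simp add: r_def algebra_simps)
  have e1: "dedekind_eta \<sigma> = of_real (sqrt 3) * r * dedekind_eta (3 * \<tau>)"
    using eta_transD[OF eta_trans_table(5) \<tau>'(1)] r3 by (simp add: \<sigma>_def)
  have "3 * \<sigma> = (9 * \<tau> - 4) / (7 * \<tau> - 3)" using p by (simp add: \<sigma>_def field_simps)
  hence e3: "dedekind_eta (3 * \<sigma>) = r * dedekind_eta \<tau>"
    using eta_transD[OF eta_trans_table(6) \<tau>] by (simp add: r_def)
  have e7: "dedekind_eta (7 * \<sigma>) = cexp (- 6 / 24) * (of_real (sqrt 3) * r) * dedekind_eta (21 * \<tau>)"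
    using eta_transD[OF eta_trans_table(7) \<tau>'(3)] r3 by (simp add: \<sigma>_def)
  have "21 * \<sigma> = (63 * \<tau> - 28) / (7 * \<tau> - 3)" using p by (simp add: \<sigma>_def field_simps)
  hence e21: "dedekind_eta (21 * \<sigma>) = cexp (6 / 24) * r * dedekind_eta (7 * \<tau>)"
    using eta_transD[OF eta_trans_table(8) \<tau>'(2)] by (simp add: r_def)
  show "X21 ((9 * \<tau> - 4) / (21 * \<tau> - 9)) = X21 \<tau>" "V21 ((9 * \<tau> - 4) / (21 * \<tau> - 9)) = 1 / V21 \<tau>"
    using level21_W3_aux[OF e1 e3 e7 e21 cexp_quarter(2,4) r0] by (simp_all only: \<sigma>_def)
qed

text \<open>Mirror image of the previous matrix, with pole at \<open>-3/7\<close> instead of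
  \<open>3/7\<close>; it serves real parts near \<open>-1/2\<close>.\<close>

lemma level21_W3':
  assumes \<tau>: "Im \<tau> > 0"
  shows "X21 ((- 9 * \<tau> - 4) / (21 * \<tau> + 9)) = X21 \<tau>" "V21 ((- 9 * \<tau> - 4) / (21 * \<tau> + 9)) = 1 / V21 \<tau>"
proof -
  have \<tau>': "Im (3 * \<tau>) > 0" "Im (7 * \<tau>) > 0" "Im (21 * \<tau>) > 0" using \<tau> by auto
  define \<sigma> where "\<sigma> = (- 9 * \<tau> - 4) / (21 * \<tau> + 9)"
  define r where "r = csqrt (- \<i> * (7 * \<tau> + 3))"
  have r0: "r \<noteq> 0" unfolding r_def using \<tau> by (intro csqrt_nonzero) auto
  have p: "7 * \<tau> + 3 \<noteq> 0" "21 * \<tau> + 9 \<noteq> 0" using moebius_pole[OF \<tau>, of 7 3] moebius_pole[OF \<tau>, of 21 9] by simp_all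
  have r3: "csqrt (- \<i> * (21 * \<tau> + 9)) = of_real (sqrt 3) * r"
    using csqrt_of_real_mult[of 3 "- \<i> * (7 * \<tau> + 3)"] by (simp add: r_def algebra_simps)
  have e1: "dedekind_eta \<sigma> = of_real (sqrt 3) * r * dedekind_eta (3 * \<tau>)"
    using eta_transD[OF eta_trans_table(9) \<tau>'(1)] r3 by (simp add: \<sigma>_def)
  have "3 * \<sigma> = (- 9 * \<tau> - 4) / (7 * \<tau> + 3)" using p by (simp add: \<sigma>_def field_simps)
  hence e3: "dedekind_eta (3 * \<sigma>) = r * dedekind_eta \<tau>"
    using eta_transD[OF eta_trans_table(10) \<tau>] by (simp add: r_def)
  have "7 * \<sigma> = (- 3 * (21 * \<tau>) - 28) / (21 * \<tau> + 9)" by (simp add: \<sigma>_def)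
  hence e7: "dedekind_eta (7 * \<sigma>) = cexp (6 / 24) * (of_real (sqrt 3) * r) * dedekind_eta (21 * \<tau>)"
    using eta_transD[OF eta_trans_table(11) \<tau>'(3)] r3 by simp
  have "21 * \<sigma> = (- 63 * \<tau> - 28) / (7 * \<tau> + 3)" using p by (simp add: \<sigma>_def field_simps)
  hence e21: "dedekind_eta (21 * \<sigma>) = cexp (- 6 / 24) * r * dedekind_eta (7 * \<tau>)"
    using eta_transD[OF eta_trans_table(12) \<tau>'(2)] by (simp add: r_def)
  show "X21 ((- 9 * \<tau> - 4) / (21 * \<tau> + 9)) = X21 \<tau>" "V21 ((- 9 * \<tau> - 4) / (21 * \<tau> + 9)) = 1 / V21 \<tau>"
    using level21_W3_aux[OF e1 e3 e7 e21 cexp_quarter(1,3) r0] by (simp_all only: \<sigma>_def)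
qed

section \<open>Level 21 and level 63 identities\<close>

definition h21 :: "complex \<Rightarrow> complex" where
  "h21 \<tau> = X21 \<tau> + 7 / X21 \<tau> + 3 - V21 \<tau> - 1 / V21 \<tau>"

text \<open>\<open>q\<close> times the part of \<open>h21\<close> consisting of its polar terms and
  the constant \<open>3\<close>.\<close>

definition N21 :: "complex \<Rightarrow> complex" where
  "N21 q = f_minus q * f_minus (q ^ 3) / (f_minus (q ^ 7) * f_minus (q ^ 21)) + 3 * q
     - (f_minus (q ^ 3) * f_minus (q ^ 7) / (f_minus q * f_minus (q ^ 21))) ^ 2"

text \<open>\<open>h21\<close> as a function of \<open>q\<close>. Division by zero makes
  \<open>N21 0 / 0\<close> equal to \<open>0\<close>, which is also the correct limit.\<close>

definition H21 :: "complex \<Rightarrow> complex" where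
  "H21 q = N21 q / q + 7 * q * (f_minus (q ^ 7) * f_minus (q ^ 21)) / (f_minus q * f_minus (q ^ 3))
     - q * (f_minus q * f_minus (q ^ 21) / (f_minus (q ^ 3) * f_minus (q ^ 7))) ^ 2"

lemma f_minus_power_nonzero:
  assumes "norm q < 1" "n > 0"
  shows "f_minus (q ^ n) \<noteq> 0"
proof -
  have "norm (q ^ n) < 1" using assms by (simp add: norm_power power_less_one_iff)
  thus ?thesis by (rule f_minus_nonzero)
qed

lemma holomorphic_f_minus_power [holomorphic_intros]:
  assumes "n > 0" "A \<subseteq> ball 0 1"
  shows "(\<lambda>q. f_minus (q ^ n)) holomorphic_on A"
proof -
  have "f_minus \<circ> (\<lambda>q. q ^ n) holomorphic_on A"
    by (rule holomorphic_on_compose_gen[OF _ holomorphic_f_minus])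
       (use assms in \<open>auto intro!: holomorphic_intros simp: norm_power power_less_one_iff subset_iff\<close>)
  thus ?thesis by (simp add: o_def)
qed

lemma f_minus_power_deriv_0:
  assumes "n > 1"
  shows "((\<lambda>q. f_minus (q ^ n)) has_field_derivative 0) (at 0)"
proof -
  have "((\<lambda>q. f_minus (q ^ n)) has_field_derivative (- 1 * (of_nat n * 0 ^ (n - Suc 0)))) (at 0)"
    using assms by (intro DERIV_chain2[where f = f_minus] derivative_eq_intros) (auto simp: f_minus_deriv_0 power_0_left)
  thus ?thesis using assms by (simp add: power_0_left)
qed

text \<open>The linear coefficients are \<open>-1\<close> from the first quotient, \<open>3\<close>,
  and \<open>-2\<close> from the square.\<close>

lemma N21_deriv_0: "(N21 has_field_derivative 0) (at 0)"
  unfolding N21_def[abs_def]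
  by (rule derivative_eq_intros f_minus_deriv_0 f_minus_power_deriv_0 refl | simp add: power_0_left)+

lemma N21_0: "N21 0 = 0"
  by (simp add: N21_def)

text \<open>The singularity at \<open>0\<close> is removable: \<open>N21\<close> vanishes there
  together with its derivative, so \<open>N21 q / q\<close> tends to \<open>0\<close>.\<close>

lemma holomorphic_H21: "H21 holomorphic_on ball 0 1"
proof (rule no_isolated_singularity'[where K = "{0}"])
  have f1: "f_minus holomorphic_on A" if "A \<subseteq> ball 0 1" for A
    using holomorphic_f_minus holomorphic_on_subset that by blast
  have nz: "f_minus q \<noteq> 0" "f_minus (q ^ 3) \<noteq> 0" "f_minus (q ^ 7) \<noteq> 0" "f_minus (q ^ 21) \<noteq> 0"
    if "norm q < 1" for q using that f_minus_power_nonzero f_minus_nonzero by auto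
  have holo_N: "N21 holomorphic_on ball 0 1"
    unfolding N21_def[abs_def] using nz by (intro holomorphic_intros f1) auto
  define G where "G = (\<lambda>q. 7 * q * (f_minus (q ^ 7) * f_minus (q ^ 21)) / (f_minus q * f_minus (q ^ 3))
     - q * (f_minus q * f_minus (q ^ 21) / (f_minus (q ^ 3) * f_minus (q ^ 7))) ^ 2)"
  have holo: "G holomorphic_on ball 0 1"
    unfolding G_def using nz by (intro holomorphic_intros f1) auto
  have H: "H21 = (\<lambda>q. N21 q / q + G q)" by (simp add: H21_def G_def fun_eq_iff)
  show "H21 holomorphic_on ball 0 1 - {0}"
    unfolding H using holo_N holo by (intro holomorphic_intros) (auto elim: holomorphic_on_subset)
  fix z :: complex assume "z \<in> {0}"
  hence [simp]: "z = 0" by simp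
  have "(\<lambda>q. N21 q / q) \<midarrow>0\<rightarrow> 0"
    using N21_deriv_0 by (simp add: has_field_derivative_iff N21_0)
  moreover have "G \<midarrow>0\<rightarrow> G 0"
    using holo by (intro isContD) (auto intro!: continuous_on_interior[of "ball 0 1"] holomorphic_on_imp_continuous_on)
  ultimately have "(\<lambda>q. N21 q / q + G q) \<midarrow>0\<rightarrow> 0 + G 0" by (rule tendsto_add)
  hence "H21 \<midarrow>0\<rightarrow> H21 0" by (simp add: H)
  thus "(H21 \<longlongrightarrow> H21 z) (at z within ball 0 1)"
    using tendsto_within_subset by force
qed auto

lemma H21_0: "H21 0 = 0" by (simp add: H21_def)

text \<open>The fractional powers of \<open>q\<close> combine to \<open>q^(-1)\<close> in both
  cases, as \<open>(1 + 3 - 7 - 21) / 24 = -1\<close> and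
  \<open>2 (3 + 7 - 1 - 21) / 24 = -1\<close>.\<close>

lemma X21_cexp:
  assumes "Im \<tau> > 0"
  defines "q \<equiv> cexp \<tau>"
  shows "X21 \<tau> = f_minus q * f_minus (q ^ 3) / (q * f_minus (q ^ 7) * f_minus (q ^ 21))"
    and "V21 \<tau> = (f_minus (q ^ 3) * f_minus (q ^ 7)) ^ 2 / (q * (f_minus q * f_minus (q ^ 21)) ^ 2)"
proof -
  have e: "dedekind_eta (of_nat n * \<tau>) = cexp (of_nat n * \<tau> / 24) * f_minus (q ^ n)" for n
    by (simp add: dedekind_eta_def q_def cexp_power)
  note e' = e[of 1] e[of 3] e[of 7] e[of 21]
  have c: "cexp (\<tau> / 24) * cexp (3 * \<tau> / 24) * q = cexp (7 * \<tau> / 24) * cexp (21 * \<tau> / 24)"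
    unfolding q_def cexp_add[symmetric] by (rule arg_cong[of _ _ cexp]) simp
  have d: "(cexp (3 * \<tau> / 24) * cexp (7 * \<tau> / 24)) ^ 2 * q = (cexp (\<tau> / 24) * cexp (21 * \<tau> / 24)) ^ 2"
    unfolding q_def cexp_add[symmetric] cexp_power unfolding cexp_add[symmetric]
    by (rule arg_cong[of _ _ cexp]) simp
  have q0: "q \<noteq> 0" by (simp add: q_def)
  have "X21 \<tau> = (cexp (\<tau> / 24) * cexp (3 * \<tau> / 24)) / (cexp (7 * \<tau> / 24) * cexp (21 * \<tau> / 24)) *
      (f_minus q * f_minus (q ^ 3) / (f_minus (q ^ 7) * f_minus (q ^ 21)))"
    using e' by (simp add: X21_def mult_ac)
  thus "X21 \<tau> = f_minus q * f_minus (q ^ 3) / (q * f_minus (q ^ 7) * f_minus (q ^ 21))"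
    unfolding c[symmetric] by simp
  have "V21 \<tau> = (cexp (3 * \<tau> / 24) * cexp (7 * \<tau> / 24)) ^ 2 / (cexp (\<tau> / 24) * cexp (21 * \<tau> / 24)) ^ 2 *
      ((f_minus (q ^ 3) * f_minus (q ^ 7)) ^ 2 / (f_minus q * f_minus (q ^ 21)) ^ 2)"
    using e' by (simp add: V21_def power_divide power_mult_distrib mult_ac)
  thus "V21 \<tau> = (f_minus (q ^ 3) * f_minus (q ^ 7)) ^ 2 / (q * (f_minus q * f_minus (q ^ 21)) ^ 2)"
    unfolding d[symmetric] by simp
qed

lemma H21_cexp:
  assumes "Im \<tau> > 0"
  shows "H21 (cexp \<tau>) = h21 \<tau>"
  unfolding H21_def N21_def h21_def X21_cexp[OF assms]
  by (simp add: add_divide_distrib diff_divide_distrib power_divide mult_ac)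

lemma h21_translate:
  assumes "Im \<tau> > 0"
  shows "h21 (\<tau> - of_int k) = h21 \<tau>"
proof -
  have "cexp (\<tau> - of_int k) = cexp \<tau>"
    using cexp_add[of "\<tau> - of_int k" "of_int k"] by simp
  thus ?thesis using H21_cexp[of \<tau>] H21_cexp[of "\<tau> - of_int k"] assms by simp
qed

lemma h21_fricke: "Im \<tau> > 0 \<Longrightarrow> h21 (- 1 / (21 * \<tau>)) = h21 \<tau>"
  unfolding h21_def by (simp only: level21_fricke) simp

text \<open>The second transformation is the inverse of the first, so its invariance follows from
  the first at the image point.\<close>

lemma h21_W7:
  assumes \<tau>: "Im \<tau> > 0"
  shows "h21 ((7 * \<tau> + 2) / (21 * \<tau> + 7)) = h21 \<tau>" "h21 ((7 * \<tau> - 2) / (- 21 * \<tau> + 7)) = h21 \<tau>"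
proof -
  have *: "h21 ((7 * \<tau> + 2) / (21 * \<tau> + 7)) = h21 \<tau>" if "Im \<tau> > 0" for \<tau>
    by (simp add: h21_def level21_W7 that)
  show "h21 ((7 * \<tau> + 2) / (21 * \<tau> + 7)) = h21 \<tau>" by (rule *[OF \<tau>])
  define \<sigma> where "\<sigma> = (7 * \<tau> - 2) / (- 21 * \<tau> + 7)"
  have p: "- 21 * \<tau> + 7 \<noteq> 0" using moebius_pole[OF \<tau>, of "-21" 7] by simp
  have "Im \<sigma> > 0"
    using Im_moebius[of "-21" \<tau> 7 7 "-2"] p \<tau> by (simp add: \<sigma>_def)
  moreover have "(7 * \<sigma> + 2) / (21 * \<sigma> + 7) = \<tau>"
  proof -
    have "7 * \<sigma> + 2 = 7 * \<tau> / (- 21 * \<tau> + 7)" "21 * \<sigma> + 7 = 7 / (- 21 * \<tau> + 7)"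
      using p by (simp_all add: \<sigma>_def field_simps)
    thus ?thesis using p by simp
  qed
  ultimately show "h21 ((7 * \<tau> - 2) / (- 21 * \<tau> + 7)) = h21 \<tau>" using *[of \<sigma>] by (simp add: \<sigma>_def)
qed

lemma h21_W3:
  assumes \<tau>: "Im \<tau> > 0"
  shows "h21 ((9 * \<tau> - 4) / (21 * \<tau> - 9)) = h21 \<tau>" "h21 ((- 9 * \<tau> - 4) / (21 * \<tau> + 9)) = h21 \<tau>"
  unfolding h21_def by (simp_all only: level21_W3[OF \<tau>] level21_W3'[OF \<tau>]) simp_all

section \<open>Raising the imaginary part and the level 21 identity\<close>

text \<open>The imaginary part is multiplied by the determinant over
  \<open>norm (c * \<tau> + d) ^ 2\<close>. \<open>B\<close> bounds the real part of
  \<open>c * \<tau> + d\<close> and \<open>C\<close> the square of its imaginary part; the margin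
  \<open>101/100\<close> makes the growth geometric.\<close>

lemma Im_moebius_ge:
  fixes \<tau> :: complex and a b c d :: int
  assumes "Im \<tau> > 0" "c \<noteq> 0" "\<bar>of_int c * Re \<tau> + of_int d\<bar> \<le> B" "of_int c ^ 2 * Im \<tau> ^ 2 \<le> C"
    "(B ^ 2 + C) * (101 / 100) \<le> of_int (a * d - b * c)"
  shows "Im ((of_int a * \<tau> + of_int b) / (of_int c * \<tau> + of_int d)) \<ge> 101 / 100 * Im \<tau>"
proof -
  have nz: "of_int c * \<tau> + of_int d \<noteq> 0" using assms by (intro moebius_pole) auto
  have "\<bar>of_int c * Re \<tau> + of_int d\<bar> ^ 2 \<le> B ^ 2" using assms(3) by (intro power_mono) auto
  hence "norm (of_int c * \<tau> + of_int d) ^ 2 \<le> B ^ 2 + C"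
    using assms(4) by (simp add: cmod_power2 power_mult_distrib)
  hence "norm (of_int c * \<tau> + of_int d) ^ 2 * (101 / 100) \<le> of_int (a * d - b * c)"
    by (intro order_trans[OF mult_right_mono assms(5)]) auto
  hence "norm (of_int c * \<tau> + of_int d) ^ 2 * (101 / 100) * Im \<tau> \<le> of_int (a * d - b * c) * Im \<tau>"
    using assms(1) by (intro mult_right_mono) auto
  moreover have "norm (of_int c * \<tau> + of_int d) ^ 2 > 0" using nz by simp
  ultimately show ?thesis
    unfolding Im_moebius[OF nz] by (simp add: pos_le_divide_eq mult_ac)
qed

text \<open>
  The isometric circles of the five transformations used here (centres \<open>0\<close>, \<open>\<plusminus>1/3\<close>, \<open>\<plusminus>3/7\<close>,
  squared radii \<open>1/21\<close>, \<open>1/63\<close>, \<open>1/147\<close>) cover the segment \<open>[-1/2, 1/2]\<close> with some room to spare.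
\<close>

lemma h21_step:
  assumes \<tau>: "Im \<tau> > 0" "Im \<tau> < 1 / 50"
  shows "\<exists>\<sigma>. Im \<sigma> \<ge> 101 / 100 * Im \<tau> \<and> h21 \<sigma> = h21 \<tau>"
proof -
  define z where "z = \<tau> - of_int (round (Re \<tau>))"
  have h: "h21 z = h21 \<tau>" unfolding z_def using \<tau> by (intro h21_translate)
  have Im: "Im z = Im \<tau>" by (simp add: z_def)
  have Re: "\<bar>Re z\<bar> \<le> 1 / 2" using of_int_round_abs_le[of "Re \<tau>"] by (simp add: z_def abs_minus_commute)
  have z: "Im z > 0" using \<tau> Im by simp
  have y: "Im z ^ 2 \<le> (1 / 50) ^ 2" using \<tau> Im by (intro power_mono) auto
  \<comment> \<open>In all five cases below \<open>c\<close> is \<open>21\<close> or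
    \<open>-21\<close>, so one bound for the vertical contribution serves throughout.\<close>
  hence C: "441 * Im z ^ 2 \<le> 441 / 2500" by (simp add: power2_eq_square)
  \<comment> \<open>The cut points keep \<open>\<bar>c * Re z + d\<bar>\<close> at most
    \<open>441/100 = 21 * 0.21\<close>, \<open>259/100 = 7 - 21 * 0.21\<close> and
    \<open>3/2 = 21 / 2 - 9\<close>, against the determinants 21, 7 and 3.\<close>
  consider "\<bar>Re z\<bar> \<le> 21 / 100" | "21 / 100 < Re z" "Re z \<le> 45 / 100" | "- (45 / 100) \<le> Re z" "Re z < - (21 / 100)"
    | "Re z > 45 / 100" | "Re z < - (45 / 100)" by linarith
  hence "\<exists>\<sigma>. Im \<sigma> \<ge> 101 / 100 * Im z \<and> h21 \<sigma> = h21 z"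
  proof cases
    case 1
    have "101 / 100 * Im z \<le> Im ((of_int 0 * z + of_int (-1)) / (of_int 21 * z + of_int 0))"
      by (rule Im_moebius_ge[where B = "441 / 100" and C = "441 / 2500"])
         (use z C 1 in \<open>auto simp: power2_eq_square abs_le_iff\<close>)
    moreover have "(of_int 0 * z + of_int (-1)) / (of_int 21 * z + of_int 0) = - 1 / (21 * z)" by simp
    ultimately show ?thesis using h21_fricke[OF z] by metis
  next
    case 2
    have "101 / 100 * Im z \<le> Im ((of_int 7 * z + of_int (-2)) / (of_int (-21) * z + of_int 7))"
      by (rule Im_moebius_ge[where B = "259 / 100" and C = "441 / 2500"])
         (use z C 2 in \<open>auto simp: power2_eq_square abs_if\<close>)
    thus ?thesis using h21_W7(2)[OF z] by auto
  next
    case 3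
    have "101 / 100 * Im z \<le> Im ((of_int 7 * z + of_int 2) / (of_int 21 * z + of_int 7))"
      by (rule Im_moebius_ge[where B = "259 / 100" and C = "441 / 2500"])
         (use z C 3 in \<open>auto simp: power2_eq_square abs_if\<close>)
    thus ?thesis using h21_W7(1)[OF z] by auto
  next
    case 4
    have "101 / 100 * Im z \<le> Im ((of_int 9 * z + of_int (-4)) / (of_int 21 * z + of_int (-9)))"
      by (rule Im_moebius_ge[where B = "3 / 2" and C = "441 / 2500"])
         (use z C 4 Re in \<open>auto simp: power2_eq_square abs_if\<close>)
    thus ?thesis using h21_W3(1)[OF z] by auto
  next
    case 5
    have "101 / 100 * Im z \<le> Im ((of_int (-9) * z + of_int (-4)) / (of_int 21 * z + of_int 9))"
      by (rule Im_moebius_ge[where B = "3 / 2" and C = "441 / 2500"])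
         (use z C 5 Re in \<open>auto simp: power2_eq_square abs_if\<close>)
    thus ?thesis using h21_W3(2)[OF z] by auto
  qed
  thus ?thesis by (simp only: h Im)
qed

text \<open>Each step multiplies the imaginary part by at least \<open>101/100\<close>, so the
  number of steps needed is bounded in advance and serves as induction variable.\<close>

lemma h21_reduce:
  assumes \<tau>: "Im \<tau> > 0"
  shows "\<exists>\<sigma>. Im \<sigma> \<ge> 1 / 50 \<and> h21 \<sigma> = h21 \<tau>"
proof -
  have *: "Im \<tau> > 0 \<Longrightarrow> Im \<tau> * (101 / 100) ^ n \<ge> 1 / 50 \<Longrightarrow> \<exists>\<sigma>. Im \<sigma> \<ge> 1 / 50 \<and> h21 \<sigma> = h21 \<tau>" for n \<tau>
  proof (induction n arbitrary: \<tau>)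
    case (Suc n)
    show ?case
    proof (cases "Im \<tau> < 1 / 50")
      case True
      obtain \<sigma> where \<sigma>: "Im \<sigma> \<ge> 101 / 100 * Im \<tau>" "h21 \<sigma> = h21 \<tau>"
        using h21_step[OF Suc.prems(1) True] by blast
      have "1 / 50 \<le> (101 / 100 * Im \<tau>) * (101 / 100) ^ n" using Suc.prems(2) by simp
      also have "\<dots> \<le> Im \<sigma> * (101 / 100) ^ n" using \<sigma>(1) by (intro mult_right_mono) auto
      finally have "\<exists>\<sigma>'. Im \<sigma>' \<ge> 1 / 50 \<and> h21 \<sigma>' = h21 \<sigma>"
        using \<sigma>(1) Suc.prems(1) by (intro Suc.IH) auto
      thus ?thesis using \<sigma>(2) by simp
    qed (intro exI[of _ \<tau>], auto)
  qed (intro exI, auto)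
  obtain n where "1 / 50 / Im \<tau> < (101 / 100) ^ n" using real_arch_pow[of "101 / 100" "1 / 50 / Im \<tau>"] by auto
  thus ?thesis using \<tau> by (intro *[of \<tau> n]) (auto simp: field_simps)
qed

lemma H21_eq_0:
  assumes "norm q < 1"
  shows "H21 q = 0"
proof -
  \<comment> \<open>\<open>cexp\<close> maps \<open>Im \<sigma> \<ge> 1 / 50\<close> into the disc
    of radius \<open>R\<close>, so by \<open>h21_reduce\<close> every value of \<open>H21\<close> on
    the unit disc is already taken on this compact disc.\<close>
  define R where "R = exp (- 2 * pi * (1 / 50))"
  have R: "0 < R" "R < 1" by (auto simp: R_def)
  have "continuous_on (cball 0 R) (\<lambda>q. norm (H21 q))"
    using R by (intro continuous_intros holomorphic_on_imp_continuous_on holomorphic_on_subset[OF holomorphic_H21]) auto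
  then obtain q0 where q0: "q0 \<in> cball 0 R" "\<And>w. w \<in> cball 0 R \<Longrightarrow> norm (H21 w) \<le> norm (H21 q0)"
    using continuous_attains_sup[of "cball 0 R" "\<lambda>q. norm (H21 q)"] R by auto
  have max: "norm (H21 w) \<le> norm (H21 q0)" if w: "w \<in> ball 0 1" for w
  proof (cases "w = 0")
    case True
    thus ?thesis using R by (intro q0(2)) auto
  next
    case False
    define \<tau> where "\<tau> = Ln w / (2 * of_real pi * \<i>)"
    have cexp: "cexp \<tau> = w" using False by (simp add: cexp_def \<tau>_def)
    have Im_pos: "Im \<tau> > 0"
    proof -
      have "exp (- 2 * pi * Im \<tau>) < exp 0" using w cexp norm_cexp[of \<tau>] by simp
      thus ?thesis unfolding exp_less_cancel_iff by (simp add: zero_less_mult_iff)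
    qed
    from h21_reduce[OF Im_pos] obtain \<sigma> where \<sigma>: "Im \<sigma> \<ge> 1 / 50" "h21 \<sigma> = h21 \<tau>" by blast
    have "H21 w = H21 (cexp \<sigma>)" using H21_cexp[of \<tau>] H21_cexp[of \<sigma>] \<sigma> Im_pos cexp by simp
    moreover have "cexp \<sigma> \<in> cball 0 R" using \<sigma>(1) by (simp add: norm_cexp R_def)
    ultimately show ?thesis using q0(2) by simp
  qed
  \<comment> \<open>The maximum over the whole unit disc is attained at the interior point
    \<open>q0\<close>.\<close>
  have "H21 constant_on ball 0 1"
    by (rule maximum_modulus_principle[OF holomorphic_H21 _ _ _ order_refl _ max]) (use q0 R in auto)
  thus ?thesis using H21_0 assms unfolding constant_on_def by (metis centre_in_ball mem_ball_0 zero_less_one)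
qed

text \<open>
  In terms of \<open>a\<close> and \<open>b\<close> this is Ramanujan's \<open>ab + 7/(ab) + 3 = (b/a)\<^sup>2 + (a/b)\<^sup>2\<close>.
\<close>

lemma level21_relation:
  assumes q: "0 < norm q" "norm q < 1"
  defines "v \<equiv> (f_minus (q ^ 3) * f_minus (q ^ 7)) ^ 2 / (q * (f_minus q * f_minus (q ^ 21)) ^ 2)"
  shows "u q 1 + 7 / u q 1 + 3 = v + 1 / v"
proof -
  have "q \<noteq> 0" using q by auto
  have "H21 q = u q 1 + 7 / u q 1 + 3 - v - 1 / v"
    unfolding H21_def N21_def u_def f_sub_def v_def using \<open>q \<noteq> 0\<close>
    by (simp add: add_divide_distrib diff_divide_distrib power_divide mult_ac)
  thus ?thesis using H21_eq_0[OF q(2)] by (simp add: algebra_simps)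
qed

section \<open>Elimination at level 63 and the final identity\<close>

lemma level63_elimination:
  fixes x y B :: complex
  assumes nz: "x \<noteq> 0" "y \<noteq> 0" "B \<noteq> 0" "x \<noteq> y"
    and x: "x + 7 / x + 3 = B / x ^ 2 + x ^ 2 / B"
    and y: "y + 7 / y + 3 = B / y ^ 2 + y ^ 2 / B"
  shows "x ^ 6 + y ^ 6 - 5 * x * y * (x ^ 4 + y ^ 4) - 20 * x ^ 2 * y ^ 2 * (x ^ 2 + y ^ 2)
     - x * y * (x ^ 2 * y ^ 2 + 49) * (x ^ 2 + x * y + y ^ 2) - 3 * x * y * (x * y + 7) * (x + y) ^ 3
     - 42 * x ^ 3 * y ^ 3 = 0" (is "?F = 0")
proof -
  \<comment> \<open>Cleared of denominators, both hypotheses become the same quadratic equation in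
    \<open>B\<close>, with \<open>t = x\<close> and with \<open>t = y\<close>.\<close>
  have quadratic: "B ^ 2 + t ^ 4 = t * (t ^ 2 + 3 * t + 7) * B"
    if "t \<noteq> 0" "t + 7 / t + 3 = B / t ^ 2 + t ^ 2 / B" for t
  proof -
    have "t * (t ^ 2 + 3 * t + 7) * B = (t + 7 / t + 3) * (t ^ 2 * B)"
      using that(1) by (simp add: field_simps power2_eq_square)
    also have "\<dots> = (B / t ^ 2 + t ^ 2 / B) * (t ^ 2 * B)" by (simp only: that(2))
    also have "\<dots> = B ^ 2 + t ^ 4"
      using that(1) nz(3) by (simp add: field_simps power2_eq_square power4_eq_xxxx)
    finally show ?thesis by simp
  qed
  have "(x - y) ^ 2 * ?F = 0"
    using quadratic[OF nz(1) x] quadratic[OF nz(2) y] by algebra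
  thus ?thesis using nz(4) by simp
qed

text \<open>The elimination applies only where \<open>u z 1\<close> and \<open>u z 3\<close> differ.
  Their poles at \<open>0\<close> have orders 1 and 3, so this open set is not empty, and the
  relation spreads from it over the connected punctured disc.\<close>

lemma level63_relation:
  fixes q :: complex
  assumes q: "0 < norm q" "norm q < 1"
  defines "F \<equiv> (\<lambda>x y :: complex. x ^ 6 + y ^ 6 - 5 * x * y * (x ^ 4 + y ^ 4) - 20 * x ^ 2 * y ^ 2 * (x ^ 2 + y ^ 2)
     - x * y * (x ^ 2 * y ^ 2 + 49) * (x ^ 2 + x * y + y ^ 2) - 3 * x * y * (x * y + 7) * (x + y) ^ 3
     - 42 * x ^ 3 * y ^ 3)"
  shows "F (u q 1) (u q 3) = 0"
proof -
  define S :: "complex set" where "S = ball 0 1 - {0}"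
  have f1: "f_minus holomorphic_on A" if "A \<subseteq> ball 0 1" for A
    using holomorphic_f_minus holomorphic_on_subset that by blast
  have nz: "f_minus z \<noteq> 0" "\<And>n. n > 0 \<Longrightarrow> f_minus (z ^ n) \<noteq> 0" if "z \<in> ball 0 1" for z
    using that f_minus_power_nonzero f_minus_nonzero by auto
  have holo: "(\<lambda>q. u q 1) holomorphic_on S" "(\<lambda>q. u q 3) holomorphic_on S"
    unfolding u_def f_sub_def S_def by (auto intro!: holomorphic_intros f1 simp: nz)
  have generic: "F (u z 1) (u z 3) = 0" if z: "z \<in> S" "u z 1 \<noteq> u z 3" for z
  proof -
    have z': "0 < norm z" "norm z < 1" "z \<noteq> 0" using z by (auto simp: S_def)
    have z3: "0 < norm (z ^ 3)" "norm (z ^ 3) < 1" using z' by (auto simp: norm_power power_less_one_iff)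
    have n: "f_minus z \<noteq> 0" "f_minus (z ^ 3) \<noteq> 0" "f_minus (z ^ 7) \<noteq> 0" "f_minus (z ^ 9) \<noteq> 0" "f_minus (z ^ 21) \<noteq> 0" "f_minus (z ^ 63) \<noteq> 0"
      using nz[of z] z'(2) by auto
    \<comment> \<open>\<open>B = b\<^sup>4\<close>, so that \<open>(a/b)\<^sup>2 = u\<^sub>1\<^sup>2 / B\<close>, and \<open>(c/b)\<^sup>2 = u\<^sub>3\<^sup>2 / B\<close> for \<open>c = f\<^sub>9/(q\<^sup>9\<^sup>/\<^sup>4 f\<^sub>6\<^sub>3)\<close>\<close>
    define B where "B = f_minus (z ^ 3) ^ 4 / (z ^ 3 * f_minus (z ^ 21) ^ 4)"
    have "B \<noteq> 0" using n z' by (simp add: B_def)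
    have ux: "u z 1 = f_minus z * f_minus (z ^ 3) / (z * f_minus (z ^ 7) * f_minus (z ^ 21))"
      by (simp add: u_def f_sub_def)
    have uy: "u z 3 = f_minus (z ^ 3) * f_minus (z ^ 9) / (z ^ 3 * f_minus (z ^ 21) * f_minus (z ^ 63))"
      by (simp add: u_def f_sub_def)
    have uy': "u (z ^ 3) 1 = u z 3" unfolding uy by (simp add: u_def f_sub_def flip: power_mult)
    have "(f_minus (z ^ 3) * f_minus (z ^ 7)) ^ 2 / (z * (f_minus z * f_minus (z ^ 21)) ^ 2) = B / u z 1 ^ 2"
      unfolding ux B_def using n z' by (simp add: field_simps power2_eq_square power3_eq_cube power4_eq_xxxx)
    hence 1: "u z 1 + 7 / u z 1 + 3 = B / u z 1 ^ 2 + u z 1 ^ 2 / B"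
      using level21_relation[OF z'(1,2)] by simp
    \<comment> \<open>At \<open>z ^ 3\<close> the quantity \<open>v\<close> is
      \<open>u z 3 ^ 2 / B\<close>, inverse to the pattern found at \<open>z\<close>; the relation
      involves only \<open>v + 1 / v\<close>, so both take the same shape.\<close>
    have "(f_minus (z ^ 9) * f_minus (z ^ 21)) ^ 2 / (z ^ 3 * (f_minus (z ^ 3) * f_minus (z ^ 63)) ^ 2) = u z 3 ^ 2 / B"
      unfolding uy B_def using n z' by (simp add: field_simps power2_eq_square power3_eq_cube power4_eq_xxxx)
    hence 2: "u z 3 + 7 / u z 3 + 3 = B / u z 3 ^ 2 + u z 3 ^ 2 / B"
      using level21_relation[OF z3] unfolding uy' by (simp add: add_ac flip: power_mult)
    have "u z 1 \<noteq> 0" "u z 3 \<noteq> 0" unfolding ux uy using n z' by auto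
    from level63_elimination[OF this \<open>B \<noteq> 0\<close> z(2) 1 2] show ?thesis unfolding F_def .
  qed
  define U where "U = {z \<in> S. u z 1 - u z 3 \<in> - {0}}"
  have S: "open S" "connected S" unfolding S_def by (auto intro!: connected_punctured_ball)
  have "open U" unfolding U_def
    using holo S by (intro continuous_open_preimage[unfolded vimage_def Int_def mem_Collect_eq] continuous_intros holomorphic_on_imp_continuous_on) auto
  have "U \<noteq> {}"
  proof
    assume "U = {}"
    hence eq: "u z 1 = u z 3" if "z \<in> S" for z using that by (auto simp: U_def)
    \<comment> \<open>Away from \<open>0\<close>, \<open>a\<close> and \<open>b\<close> are
      \<open>z ^ 3 * u z 1\<close> and \<open>z ^ 3 * u z 3\<close>. Their limits at
      \<open>0\<close> are \<open>0\<close> and \<open>1\<close>, which contradicts equality of the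
      two functions.\<close>
    define a where "a = (\<lambda>z. z ^ 2 * (f_minus z * f_minus (z ^ 3)) / (f_minus (z ^ 7) * f_minus (z ^ 21)))"
    define b where "b = (\<lambda>z. f_minus (z ^ 3) * f_minus (z ^ 9) / (f_minus (z ^ 21) * f_minus (z ^ 63)))"
    have "isCont a 0" "isCont b 0" unfolding a_def b_def
      by (auto intro!: continuous_on_interior[of "ball 0 1"] holomorphic_on_imp_continuous_on holomorphic_intros f1 simp: nz)
    hence lim: "a \<midarrow>0\<rightarrow> 0" "b \<midarrow>0\<rightarrow> 1" by (auto simp: isCont_def a_def b_def)
    have "\<forall>\<^sub>F z in at 0. z \<in> S" unfolding S_def
      using eventually_at_in_open[of "ball 0 1" "0 :: complex"] by simp
    hence "\<forall>\<^sub>F z in at 0. a z = b z"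
    proof eventually_elim
      case (elim z)
      have "z \<noteq> 0" using elim by (simp add: S_def)
      hence "a z = z ^ 3 * u z 1" "b z = z ^ 3 * u z 3"
        by (simp_all add: a_def b_def u_def f_sub_def power2_eq_square power3_eq_cube)
      thus ?case using eq[OF elim] by simp
    qed
    from Lim_transform_eventually[OF lim(1) this] lim(2) have "(0::complex) = 1"
      by (intro tendsto_unique[of "at 0" b]) auto
    thus False by simp
  qed
  show ?thesis
  proof (rule analytic_continuation_open[OF \<open>open U\<close> S(1) \<open>U \<noteq> {}\<close> S(2), where f = "\<lambda>z. F (u z 1) (u z 3)" and g = "\<lambda>_. 0"])
    show "(\<lambda>z. F (u z 1) (u z 3)) holomorphic_on S"
      unfolding F_def using holo by (intro holomorphic_intros)
  qed (use generic q in \<open>auto simp: U_def S_def\<close>)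
qed

theorem theorem3p2:
  fixes q P Q sqrtP sqrtQ :: complex
  assumes "0 < norm q" and "norm q < 1"
    and "P = u q 1 * u q 3"
    and "Q = u q 1 / u q 3"
    and "sqrtP ^ 2 = P" and "sqrtQ ^ 2 = Q"
    and "sqrtP * sqrtQ = u q 1"
  shows "Q ^ 3 + 1 / Q ^ 3 =
      5 * (Q ^ 2 + 1 / Q ^ 2) + 20 * (Q + 1 / Q)
      + (P + 7 ^ 2 / P) * (Q + 1 / Q + 1)
      + 3 * (sqrtP + 7 / sqrtP)
          * ((sqrtQ ^ 3 + 1 / sqrtQ ^ 3) + 3 * (sqrtQ + 1 / sqrtQ))
      + 42"
proof -
  \<comment> \<open>All quantities become monomials in \<open>t\<close> and \<open>y\<close>, which
    removes the radicals. The condition \<open>sqrtP * sqrtQ = u q 1\<close> fixes the sign in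
    \<open>sqrtP = t * y\<close>.\<close>
  define t y where "t = sqrtQ" and "y = u q 3"
  have q: "q \<noteq> 0" using assms(1) by auto
  have n: "f_minus (q ^ n) \<noteq> 0" if "n > 0" for n
    using assms(2) that by (rule f_minus_power_nonzero)
  have nz: "u q 1 \<noteq> 0" "y \<noteq> 0" using q n n[of 1] by (auto simp: u_def f_sub_def y_def)
  have "sqrtP ^ 2 = sqrtP * t * y" using assms(3,5,7) by (simp add: t_def y_def)
  moreover have "sqrtP \<noteq> 0" "t \<noteq> 0" using nz assms(7) by (auto simp: t_def)
  ultimately have s: "sqrtP = t * y" by (simp add: power2_eq_square)
  have x: "u q 1 = t ^ 2 * y" using assms(7) s by (simp add: t_def power2_eq_square mult_ac)
  have Q: "Q = t ^ 2" "sqrtQ = t" using assms(6) by (auto simp: t_def)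
  have P: "P = t ^ 2 * y ^ 2" using assms(5) s by (simp add: power_mult_distrib)
  note F = level63_relation[OF assms(1,2), unfolded x, folded y_def]
  \<comment> \<open>The claim is the polynomial relation divided by
    \<open>u\<^sub>1\<^sup>3 u\<^sub>3\<^sup>3 = t^6 y^6\<close>. The numerator is written as
    \<open>0\<close> so that unfolding \<open>F[symmetric]\<close> can replace it by the
    polynomial.\<close>
  have "Q ^ 3 + 1 / Q ^ 3 - (5 * (Q ^ 2 + 1 / Q ^ 2) + 20 * (Q + 1 / Q)
      + (P + 7 ^ 2 / P) * (Q + 1 / Q + 1)
      + 3 * (sqrtP + 7 / sqrtP)
          * ((sqrtQ ^ 3 + 1 / sqrtQ ^ 3) + 3 * (sqrtQ + 1 / sqrtQ))
      + 42) = 0 / (t ^ 6 * y ^ 6)"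
    unfolding F[symmetric] Q P s using nz \<open>t \<noteq> 0\<close>
    by (simp add: field_simps) algebra
  thus ?thesis by simp
qed

end
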